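(* Let $n,m,z$ be positive integers with $z\le n$, let $A\in\mathbb{R}^{n\times n}$, $B\in\mathbb{R}^{n\times m}$, $C\in\mathbb{R}^{z\times n}$, let $\mu$ be the degree of the minimal polynomial of $A$, and let $\alpha>0$ be real with $k-1<\alpha\le k$, $k$ a positive integer. Let $t>0$ be finite. The Caputo fractional differential system of order $\alpha$ $$\left({}^{C}D_{0+}^{\alpha}x_\alpha\right)(\tau)=Ax_\alpha(\tau)+Bu(\tau),\qquad y_\alpha(\tau)=Cx_\alpha(\tau),$$ is observable in $[0,t]$ if and only if any one of the following three equivalent conditions holds: 1) $\operatorname{rank}\left[\,C^T \;\; A^TC^T\;\cdots\;(A^T)^{\mu-1}C^T\right]=n$; 2) $\operatorname{rank}\left[\lambda I_n-A^T \;\; C^T\right]=n$ for all $\lambda\in\sigma(A)$, where $\sigma(A)\subset\mathbb{C}$ is the spectrum of $A$; 3) $\displaystyle\int_0^{T}\Psi_\alpha^T(\tau)C^TC\Psi_\alpha(\tau)\,d\tau\succ0$ (positive definite) for any finite time interval $[0,T]$ of nonzero measure, where $\Psi_\alpha(\tau):=\left[\Phi_{\alpha0}(\tau)\;\;\tau\Phi_{\alpha1}(\tau)\;\cdots\;\tau^{k-1}\Phi_{\alpha,k-1}(\tau)\right]\in\mathbb{R}^{n\times kn}$.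
   Context: The system is given initial conditions $x_\alpha^{(j)}(0)=x_{0j}\in\mathbb{R}^n$, $j=0,1,\dots,k-1$. Admissible controls $u:[0,\infty)\to\mathbb{R}^m$ are bounded piecewise continuous functions. For each such $u$ and each set of initial conditions, the unique solution of the Caputo system on $[0,\infty)$ is $$x_\alpha(t)=\sum_{j=0}^{k-1}t^{j}\Phi_{\alpha j}(t)x_{0j}+\int_0^t(t-\tau)^{\alpha-1}\Phi_\alpha(t-\tau)Bu(\tau)\,d\tau,$$ $$\Phi_{\alpha j}(t)=\sum_{\ell=0}^{\infty}\frac{A^\ell t^{\alpha\ell}}{\Gamma(\alpha\ell+j+1)},\qquad \Phi_\alpha(t)=\sum_{\ell=0}^{\infty}\frac{A^\ell t^{\alpha\ell}}{\Gamma(\alpha(\ell+1))},$$ where $\Gamma$ is the Gamma function. The system of order $\alpha$ is observable in the observation interval $[0,t]$, $t>0$, if the initial conditions $x_{00},\dots,x_{0,k-1}$ can be uniquely determined from the output $y_\alpha(\tau)$, $\tau\in[0,t]$, the control $u$ being known; that is, for a given admissible $u$, two sets of initial conditions producing the same output on $[0,t]$ coincide. (The property does not depend on the choice of the finite $t>0$.) *)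

theory Defs
  imports
    "HOL-Analysis.Henstock_Kurzweil_Integration"
    "HOL-Analysis.Gamma_Function"
    "Jordan_Normal_Form.DL_Rank"
    "Jordan_Normal_Form.Spectral_Radius"
begin

section \<open>Matrices\<close>

text \<open>The block row \<open>[F 0, F 1, \<dots>, F (N - 1)]\<close> of \<open>r \<times> c\<close> matrices.\<close>

definition block_row :: "nat \<Rightarrow> nat \<Rightarrow> nat \<Rightarrow> (nat \<Rightarrow> 'a mat) \<Rightarrow> 'a mat" where
  "block_row r c N F = mat r (N * c) (\<lambda>(i, j). F (j div c) $$ (i, j mod c))"

definition append_cols :: "'a mat \<Rightarrow> 'a mat \<Rightarrow> 'a mat" where
  "append_cols M N = mat (dim_row M) (dim_col M + dim_col N)
     (\<lambda>(i, j). if j < dim_col M then M $$ (i, j) else N $$ (i, j - dim_col M))"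

definition poly_mat :: "'a::comm_ring_1 poly \<Rightarrow> 'a mat \<Rightarrow> 'a mat" where
  "poly_mat p M = mat (dim_row M) (dim_row M)
     (\<lambda>(i, j). \<Sum>l\<le>degree p. coeff p l * (M ^\<^sub>m l) $$ (i, j))"

definition minimal_poly :: "'a::field mat \<Rightarrow> 'a poly" where
  "minimal_poly M = (THE p. monic p \<and> poly_mat p M = 0\<^sub>m (dim_row M) (dim_row M) \<and>
     (\<forall>q. q \<noteq> 0 \<and> poly_mat q M = 0\<^sub>m (dim_row M) (dim_row M) \<longrightarrow> degree p \<le> degree q))"

definition pos_def_mat :: "real mat \<Rightarrow> bool" where
  "pos_def_mat M \<longleftrightarrow> square_mat M \<and> transpose_mat M = M \<and>
     (\<forall>v\<in>carrier_vec (dim_row M). v \<noteq> 0\<^sub>v (dim_row M) \<longrightarrow> v \<bullet> (M *\<^sub>v v) > 0)"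

section \<open>Caputo derivatives\<close>

text \<open>The \<open>j\<close>-th derivative on the half-line \<open>[0, \<infinity>)\<close>, one-sided at \<open>0\<close>.\<close>

primrec hderiv :: "nat \<Rightarrow> (real \<Rightarrow> real) \<Rightarrow> real \<Rightarrow> real" where
  "hderiv 0 f = f"
| "hderiv (Suc j) f = (\<lambda>t. vector_derivative (hderiv j f) (at t within {0..}))"

definition hdiff :: "nat \<Rightarrow> (real \<Rightarrow> real) \<Rightarrow> bool" where
  "hdiff r f \<longleftrightarrow> (\<forall>j<r. \<forall>t\<ge>0. hderiv j f differentiable (at t within {0..}))"

text \<open>The Riemann--Liouville integral of order \<open>\<beta> \<ge> 0\<close> based at \<open>0\<close>; order \<open>0\<close> is the identity.\<close>

definition rl_integral :: "real \<Rightarrow> (real \<Rightarrow> real) \<Rightarrow> real \<Rightarrow> real" where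
  "rl_integral \<beta> f t =
     (if \<beta> = 0 then f t
      else integral {0..t} (\<lambda>\<tau>. (t - \<tau>) powr (\<beta> - 1) * f \<tau>) / Gamma \<beta>)"

text \<open>For \<open>k - 1 < \<alpha> \<le> k\<close> the Caputo derivative of \<open>f\<close> is the Riemann--Liouville derivative of
  \<open>f\<close> minus its Taylor polynomial of degree \<open>k - 1\<close> at \<open>0\<close>,
  \[ ({}^C D^\alpha_{0+} f)(t) = \frac{d^k}{dt^k}\, I^{k-\alpha}_{0+}
       \Bigl(f - \sum_{j<k} \frac{f^{(j)}(0)}{j!}\, s^j\Bigr)(t). \]
  It coincides with \<open>I\<^sup>k\<^sup>-\<^sup>\<alpha> f\<^sup>(\<^sup>k\<^sup>)\<close> when \<open>f\<^sup>(\<^sup>k\<^sup>-\<^sup>1\<^sup>)\<close> is absolutely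
  continuous. The form above does not need that, which matters because the state of a fractional
  system driven by a merely continuous control is in general not that regular.
  The predicate says that the derivative exists at \<open>t\<close> and equals \<open>D\<close>.\<close>

definition has_caputo_deriv :: "nat \<Rightarrow> real \<Rightarrow> (real \<Rightarrow> real) \<Rightarrow> real \<Rightarrow> real \<Rightarrow> bool" where
  "has_caputo_deriv k \<alpha> f D t \<longleftrightarrow>
     (let g = rl_integral (real k - \<alpha>) (\<lambda>s. f s - (\<Sum>j<k. hderiv j f 0 / fact j * s ^ j))
      in hdiff (k - 1) g \<and> (hderiv (k - 1) g has_real_derivative D) (at t within {0..}))"

section \<open>The control system\<close>

definition piecewise_continuous :: "(real \<Rightarrow> real) \<Rightarrow> bool" where
  "piecewise_continuous f \<longleftrightarrow>
     (\<forall>T. finite {\<tau>\<in>{0..T}. \<not> continuous (at \<tau> within {0..}) f}) \<and>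
     (\<forall>\<tau>\<ge>0. \<exists>l. (f \<longlongrightarrow> l) (at_right \<tau>)) \<and>
     (\<forall>\<tau>>0. \<exists>l. (f \<longlongrightarrow> l) (at_left \<tau>))"

definition admissible_control :: "nat \<Rightarrow> (real \<Rightarrow> real vec) \<Rightarrow> bool" where
  "admissible_control m u \<longleftrightarrow>
     (\<forall>\<tau>\<ge>0. u \<tau> \<in> carrier_vec m) \<and>
     (\<forall>i<m. piecewise_continuous (\<lambda>\<tau>. u \<tau> $ i) \<and> bounded ((\<lambda>\<tau>. u \<tau> $ i) ` {0..}))"

text \<open>Solutions on \<open>[0, \<infinity>)\<close> of \<open>\<^sup>CD\<^sup>\<alpha> x = A x + B u\<close> with \<open>x\<^sup>(\<^sup>j\<^sup>)(0) = x0 j\<close> for \<open>j < k\<close>. The state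
  is \<open>k - 1\<close> times continuously differentiable, so that the initial conditions make sense, and the
  equation is required at every \<open>\<tau> > 0\<close> where the control is continuous; it cannot be expected
  to hold where the control jumps.\<close>

definition caputo_solution ::
  "nat \<Rightarrow> real \<Rightarrow> real mat \<Rightarrow> real mat \<Rightarrow> (real \<Rightarrow> real vec) \<Rightarrow> (nat \<Rightarrow> real vec) \<Rightarrow>
    (real \<Rightarrow> real vec) \<Rightarrow> bool" where
  "caputo_solution k \<alpha> A B u x0 x \<longleftrightarrow>
     (\<forall>\<tau>\<ge>0. x \<tau> \<in> carrier_vec (dim_row A)) \<and>
     (\<forall>i<dim_row A.
        hdiff (k - 1) (\<lambda>\<tau>. x \<tau> $ i) \<and> continuous_on {0..} (hderiv (k - 1) (\<lambda>\<tau>. x \<tau> $ i)) \<and>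
        (\<forall>j<k. hderiv j (\<lambda>\<tau>. x \<tau> $ i) 0 = x0 j $ i)) \<and>
     (\<forall>\<tau>>0. (\<forall>l<dim_col B. isCont (\<lambda>s. u s $ l) \<tau>) \<longrightarrow>
        (\<forall>i<dim_row A. has_caputo_deriv k \<alpha> (\<lambda>s. x s $ i) ((A *\<^sub>v x \<tau> + B *\<^sub>v u \<tau>) $ i) \<tau>))"

text \<open>The output \<open>y = C x\<close> on \<open>[0, t]\<close> determines the initial conditions, the control being known.\<close>

definition observable ::
  "nat \<Rightarrow> real \<Rightarrow> real mat \<Rightarrow> real mat \<Rightarrow> real mat \<Rightarrow> real \<Rightarrow> bool" where
  "observable k \<alpha> A B C t \<longleftrightarrow>
     (\<forall>u x0 x0' x x'.
        admissible_control (dim_col B) u \<and>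
        (\<forall>j<k. x0 j \<in> carrier_vec (dim_row A) \<and> x0' j \<in> carrier_vec (dim_row A)) \<and>
        caputo_solution k \<alpha> A B u x0 x \<and> caputo_solution k \<alpha> A B u x0' x' \<and>
        (\<forall>\<tau>\<in>{0..t}. C *\<^sub>v x \<tau> = C *\<^sub>v x' \<tau>) \<longrightarrow>
        (\<forall>j<k. x0 j = x0' j))"

text \<open>The entries of \<open>\<Phi>\<^sub>\<alpha>\<^sub>j(t) = \<Sum>\<^sub>l A\<^sup>l t\<^sup>\<alpha>\<^sup>l / \<Gamma>(\<alpha> l + j + 1)\<close>. The power \<open>t\<^sup>\<alpha>\<^sup>l\<close> is written
  \<open>(t powr \<alpha>) ^ l\<close> because \<open>0 powr 0 = 0\<close> would give the wrong value of the term \<open>l = 0\<close> at \<open>t = 0\<close>.\<close>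

definition Phi :: "real \<Rightarrow> real mat \<Rightarrow> nat \<Rightarrow> real \<Rightarrow> real mat" where
  "Phi \<alpha> A j t = mat (dim_row A) (dim_row A)
     (\<lambda>(p, q). \<Sum>l. (A ^\<^sub>m l) $$ (p, q) * (t powr \<alpha>) ^ l / Gamma (\<alpha> * real l + real j + 1))"

definition Psi :: "nat \<Rightarrow> real \<Rightarrow> real mat \<Rightarrow> real \<Rightarrow> real mat" where
  "Psi k \<alpha> A t = block_row (dim_row A) (dim_row A) k (\<lambda>j. t ^ j \<cdot>\<^sub>m Phi \<alpha> A j t)"

definition obs_gramian :: "nat \<Rightarrow> real \<Rightarrow> real mat \<Rightarrow> real mat \<Rightarrow> real \<Rightarrow> real mat" where
  "obs_gramian k \<alpha> A C T = mat (k * dim_row A) (k * dim_row A)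
     (\<lambda>ij. integral {0..T}
       (\<lambda>\<tau>. (transpose_mat (Psi k \<alpha> A \<tau>) * transpose_mat C * C * Psi k \<alpha> A \<tau>) $$ ij))"

end

theory Submission
  imports Defs "HOL-Analysis.Equivalence_Measurable_On_Borel"
begin

text \<open>Call \<open>v\<close> unobservable if \<open>C A\<^sup>l v = 0\<close> for all \<open>l\<close>; all four conditions say that only
  \<open>v = 0\<close> is unobservable.

  If a row vector \<open>c\<close> satisfies \<open>c x = c x'\<close> on \<open>[0, t]\<close>, then derivatives at \<open>0\<close> give
  \<open>c x\<^sub>0\<^sub>j = c x'\<^sub>0\<^sub>j\<close>, and comparing Caputo derivatives gives \<open>c A x = c A x'\<close> on \<open>[0, t]\<close>. Starting
  from the rows of \<open>C\<close>, the differences of the initial conditions are unobservable. This direction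
  needs nothing but linearity and locality of the Caputo derivative.

  Conversely, the Mittag-Leffler type series \<open>\<Psi>\<^sub>\<alpha> w\<close> solve the uncontrolled system, and for
  unobservable initial conditions their output vanishes. Since \<open>w\<^sup>T W w\<close> is the integral of
  \<open>\<bar>C \<Psi>\<^sub>\<alpha> w\<bar>\<^sup>2\<close> for the Gramian \<open>W\<close>, the Gramian is definite exactly when these outputs
  determine \<open>w\<close>. The two rank conditions are linear algebra, via the minimal polynomial and via
  an eigenvector inside the unobservable subspace.\<close>

text \<open>Two features of the setting shape the argument. The state equation is only available
  where the control is continuous, so comparing two solutions gives equalities off a finite set,
  which continuity of the states extends to the whole interval. And series in t powr \<alpha> need
  not be smooth at 0, where the initial data are read off: term l of a free component behaves like t
  powr (\<alpha> l + j), and splitting off the monomial l = 0 leaves exponents at least \<alpha> + j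
  > k - 1, so that k - 1 one-sided derivatives exist at 0 and see only that monomial. The calculus
  is done in one family, t powr \<gamma> times a series with denominators \<Gamma>(\<alpha> l +
  \<gamma> + 1), because fractional integration of order \<beta> shifts \<gamma> by \<beta> and
  differentiation shifts it by -1. The Caputo derivative then merely drops the first coefficient,
  which for the coefficients A^l v is multiplication by A. Eigenvalues may be non-real, so the
  eigenvector argument runs over the complex numbers; real and imaginary parts bring it
  back.\<close>

no_notation inner (infix \<open>\<bullet>\<close> 70)
no_notation vec_nth (infixl \<open>$\<close> 90)

section \<open>The rank of a wide matrix\<close>

text \<open>Zero rows pad the matrix to a singular square one. Used twice: to find a vector
  orthogonal to fewer than n columns, and to find an annihilating polynomial.\<close>

lemma wide_matrix_kernel:
  fixes M :: "'a::field mat"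
  assumes M: "M \<in> carrier_mat r n" and "r < n"
  obtains v where "v \<in> carrier_vec n" "v \<noteq> 0\<^sub>v n" "M *\<^sub>v v = 0\<^sub>v r"
proof -
  define Q where "Q = mat n n (\<lambda>(i, j). if i < r then M $$ (i, j) else 0)"
  have Q: "Q \<in> carrier_mat n n" by (simp add: Q_def)
  \<comment> \<open>Row \<open>r\<close> exists because r < n and is one of the zero rows; the
    determinant is expanded along it.\<close>
  have "det Q = 0"
    using laplace_expansion_row[OF Q assms(2)] assms(2) by (simp add: Q_def)
  then obtain v where v: "v \<in> carrier_vec n" "v \<noteq> 0\<^sub>v n" "Q *\<^sub>v v = 0\<^sub>v n"
    using det_0_iff_vec_prod_zero_field[OF Q] by blast
  have "M *\<^sub>v v = 0\<^sub>v r"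
  proof (rule eq_vecI)
    fix i assume i: "i < dim_vec (0\<^sub>v r :: 'a vec)"
    then have "row M i = row Q i" using assms by (auto simp: Q_def row_def)
    moreover have "(Q *\<^sub>v v) $ i = 0" using v(3) i assms(2) by simp
    ultimately show "(M *\<^sub>v v) $ i = (0\<^sub>v r :: 'a vec) $ i"
      using i M Q assms(2) by simp
  qed (use M in auto)
  then show ?thesis using v that by blast
qed

text \<open>A maximal independent set \<open>S\<close> of columns has the same orthogonal complement
  as all columns. With n elements it spans, and only 0 is orthogonal to everything; with fewer, the
  matrix with rows \<open>S\<close> is wide and has a kernel vector. The product is bilinear,
  without conjugation, so this works over every field and turns both rank conditions into kernel
  conditions.\<close>

lemma rank_eq_dim_row_iff:
  fixes M :: "'a::field mat"
  assumes M: "M \<in> carrier_mat n nc"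
  shows "vec_space.rank n M = n \<longleftrightarrow>
    (\<forall>v\<in>carrier_vec n. transpose_mat M *\<^sub>v v = 0\<^sub>v nc \<longrightarrow> v = 0\<^sub>v n)"
proof -
  interpret vec_space "TYPE('a)" n .
  let ?C = "set (cols M)"
  have C: "?C \<subseteq> carrier_vec n" using cols_dim M by blast
  have ortho: "transpose_mat M *\<^sub>v v = 0\<^sub>v nc \<longleftrightarrow> v \<in> orthogonal_complement ?C"
    if "v \<in> carrier_vec n" for v
  proof -
    have "transpose_mat M *\<^sub>v v = 0\<^sub>v nc \<longleftrightarrow> (\<forall>j<nc. col M j \<bullet> v = 0)"
      using M that by (auto simp: vec_eq_iff)
    also have "\<dots> \<longleftrightarrow> v \<in> orthogonal_complement ?C"
      using M that comm_scalar_prod[OF that]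
      by (auto simp: orthogonal_complement_def cols_def)

    finally show ?thesis .
  qed
  obtain S where S: "finite S" "maximal S (\<lambda>T. T \<subseteq> ?C \<and> lin_indpt T)"
    using maximal_exists_superset[of ?C "\<lambda>T. T \<subseteq> ?C \<and> lin_indpt T" "{}"]
      finite_lin_indpt2[of "{}"] by auto
  have rk: "rank M = card S" by (rule rank_card_indpt[OF M S(2)])
  have SC: "S \<subseteq> ?C" and li: "lin_indpt S" using S(2) by (auto simp: maximal_def)
  have Sn: "S \<subseteq> carrier_vec n" using SC C by blast
  have sp: "?C \<subseteq> span S"
  proof
    fix c assume c: "c \<in> ?C"
    show "c \<in> span S"
    proof (rule ccontr)
      assume n: "c \<notin> span S"
      then have "c \<notin> S" using Sn in_own_span by blast
      moreover have "lin_indpt (S \<union> {c})"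
        using lin_dep_iff_in_span[OF _ li _ \<open>c \<notin> S\<close>] Sn C c n by auto
      ultimately show False using S(2) c SC unfolding maximal_def by blast
    qed
  qed
  have le: "card S \<le> n" using li_le_dim[of S] Sn li dim_is_n S(1) by auto
  have oc: "orthogonal_complement S = orthogonal_complement ?C"
    using in_orthogonal_complement_span[OF Sn] orthogonal_complement_subset[OF sp]
      orthogonal_complement_subset[OF SC] by blast
  show ?thesis
  proof
    assume "rank M = n"
    then have "card S = dim" using rk dim_is_n by simp
    then have "basis S" using dim_li_is_basis[of S] S(1) Sn li by auto
    then have spS: "span S = carrier_vec n" by (simp add: basis_def)
    show "\<forall>v\<in>carrier_vec n. transpose_mat M *\<^sub>v v = 0\<^sub>v nc \<longrightarrow> v = 0\<^sub>v n"
    proof (intro ballI impI)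
      fix v :: "'a vec" assume v: "v \<in> carrier_vec n" "transpose_mat M *\<^sub>v v = 0\<^sub>v nc"
      then have "v \<in> orthogonal_complement (carrier_vec n)"
        using ortho oc in_orthogonal_complement_span[OF Sn] spS by auto
      then have "v \<bullet> unit_vec n i = 0" for i
        by (auto simp: orthogonal_complement_def)
      then have "v $ i = 0" if "i < n" for i
        using that v(1) scalar_prod_right_unit[of i n v] by auto
      then show "v = 0\<^sub>v n" using v(1) by (auto simp: vec_eq_iff)
    qed
  next
    assume *: "\<forall>v\<in>carrier_vec n. transpose_mat M *\<^sub>v v = 0\<^sub>v nc \<longrightarrow> v = 0\<^sub>v n"
    show "rank M = n"
    proof (rule ccontr)
      assume "rank M \<noteq> n"
      then have lt: "card S < n" using le rk by simp
      obtain ws where ws: "set ws = S" "distinct ws" using S(1) finite_distinct_list by blast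
      have "mat_of_rows n ws \<in> carrier_mat (length ws) n" by simp
      moreover have "length ws < n" using lt ws distinct_card by force
      ultimately obtain v where v: "v \<in> carrier_vec n" "v \<noteq> 0\<^sub>v n"
          "mat_of_rows n ws *\<^sub>v v = 0\<^sub>v (length ws)"
        by (rule wide_matrix_kernel)
      have "v \<bullet> w = 0" if "w \<in> S" for w
      proof -
        obtain i where i: "i < length ws" "ws ! i = w"
          using \<open>w \<in> S\<close> unfolding ws(1)[symmetric] by (auto simp: in_set_conv_nth)
        have "(mat_of_rows n ws *\<^sub>v v) $ i = 0" using v(3) i by simp
        then have "w \<bullet> v = 0" using i Sn that by auto
        then show ?thesis using comm_scalar_prod v(1) Sn that by (metis subsetD)
      qed
      then have "v \<in> orthogonal_complement ?C" using oc v(1) by (auto simp: orthogonal_complement_def)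
      then show False using ortho * v by blast
    qed
  qed
qed

section \<open>Caputo derivatives\<close>

text \<open>The interval \<open>{0..<T}\<close> is open relative to \<open>{0..}\<close>, so
  agreement there passes to all one-sided derivatives, including those at 0.\<close>

lemma hderiv_cong:
  assumes "\<And>s. 0 \<le> s \<Longrightarrow> s < T \<Longrightarrow> f s = g s" "0 \<le> s" "s < T"
  shows "hderiv j f s = hderiv j g s"
  using assms(2,3)
proof (induction j arbitrary: s)
  case (Suc j)
  have "eventually (\<lambda>x. x \<in> {..<T}) (nhds s)"
    using Suc.prems by (intro eventually_nhds_in_open) auto
  then have "eventually (\<lambda>x. x \<in> {0..} \<longrightarrow> hderiv j f x = hderiv j g x) (nhds s)"
    by eventually_elim (auto intro: Suc.IH)
  then show ?case
    using Suc.prems by (auto intro!: vector_derivative_cong_eq)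
qed (use assms(1) in auto)

lemma hderiv_step:
  assumes "hdiff r f" "j < r" "0 \<le> s"
  shows "(hderiv j f has_real_derivative hderiv (Suc j) f s) (at s within {0..})"
  using assms unfolding hdiff_def
  by (auto simp: has_real_derivative_iff_has_vector_derivative vector_derivative_works[symmetric])

lemma halfline_nontrivial_limit:
  assumes "0 \<le> s"
  shows "at (s::real) within {0..} \<noteq> bot"
proof
  assume "at s within {0..} = bot"
  moreover have "at_right s \<le> at s within {0..}"
    using assms by (intro at_le) auto
  ultimately show False by (simp add: bot_unique)
qed

text \<open>\<open>vector_derivative\<close> is a choice operator, so \<open>hderiv\<close> is
  awkward to unfold. A chain \<open>d\<close> of actual derivatives determines it, since derivatives
  within the half-line are unique; the regularity of sums and of series is shown by exhibiting such
  a chain.\<close>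

lemma
  assumes "\<And>s. 0 \<le> s \<Longrightarrow> d 0 s = f s"
    and "\<And>j s. j < r \<Longrightarrow> 0 \<le> s \<Longrightarrow> (d j has_real_derivative d (Suc j) s) (at s within {0..})"
  shows hderiv_eqI: "\<And>j s. j \<le> r \<Longrightarrow> 0 \<le> s \<Longrightarrow> hderiv j f s = d j s"
    and hdiffI: "hdiff r f"
proof -
  have step: "(hderiv j f has_real_derivative d (Suc j) s) (at s within {0..})"
    if "j < r" "0 \<le> s" "\<And>s. 0 \<le> s \<Longrightarrow> hderiv j f s = d j s" for j s
    by (rule has_field_derivative_transform_within[where d = 1, OF assms(2)[OF that(1,2)]])
       (use that(2,3) in auto)
  show eq: "hderiv j f s = d j s" if "j \<le> r" "0 \<le> s" for j s
    using that
  proof (induction j arbitrary: s)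
    case (Suc j)
    then show ?case
      using step[of j s] vector_derivative_within[OF halfline_nontrivial_limit[of s]]
      by (simp add: has_real_derivative_iff_has_vector_derivative)
  qed (use assms(1) in simp)
  show "hdiff r f"
    unfolding hdiff_def using step eq real_differentiable_def by (meson less_imp_le)
qed

lemma
  assumes "\<And>i. i \<in> I \<Longrightarrow> hdiff r (f i)"
  shows hderiv_sum: "\<And>j s. j \<le> r \<Longrightarrow> 0 \<le> s \<Longrightarrow>
      hderiv j (\<lambda>s. \<Sum>i\<in>I. c i * f i s) s = (\<Sum>i\<in>I. c i * hderiv j (f i) s)"
    and hdiff_sum: "hdiff r (\<lambda>s. \<Sum>i\<in>I. c i * f i s)"
proof -
  let ?d = "\<lambda>j s. \<Sum>i\<in>I. c i * hderiv j (f i) s"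
  have "(?d j has_real_derivative ?d (Suc j) s) (at s within {0..})" if "j < r" "0 \<le> s" for j s
    by (intro DERIV_sum DERIV_cmult hderiv_step[of r]) (use assms that in blast)+
  note d = this
  show "hderiv j (\<lambda>s. \<Sum>i\<in>I. c i * f i s) s = ?d j s" if "j \<le> r" "0 \<le> s" for j s
    using that by (intro hderiv_eqI[of ?d _ r] d) simp_all
  show "hdiff r (\<lambda>s. \<Sum>i\<in>I. c i * f i s)"
    by (intro hdiffI[of ?d] d) simp_all
qed

lemma continuous_on_hdiff:
  assumes "hdiff r f" "continuous_on {0..} (hderiv r f)"
  shows "continuous_on {0..} f"
proof (cases r)
  case (Suc r')
  then show ?thesis
    using DERIV_continuous[OF hderiv_step[OF assms(1), of 0]]
    by (auto simp: continuous_on_eq_continuous_within)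
qed (use assms in simp)

section \<open>Fractional integrals\<close>

text \<open>The substitution s = t x reduces this to the Beta integral. It is the fractional
  integral of a monomial, up to the factor \<open>Gamma \<beta>\<close>.\<close>

lemma has_integral_Abel_kernel_powr:
  fixes t \<beta> p :: real
  assumes "0 < t" "0 < \<beta>" "0 \<le> p"
  shows "((\<lambda>s. (t - s) powr (\<beta> - 1) * s powr p) has_integral
    t powr (p + \<beta>) * Gamma \<beta> * Gamma (p + 1) / Gamma (p + \<beta> + 1)) {0..t}"
proof -
  have *: "((\<lambda>x. x powr (p + 1 - 1) * (1 - x) powr (\<beta> - 1)) has_integral Beta (p + 1) \<beta>) {0..1}"
    using assms by (intro has_integral_Beta_real) auto
  have im: "(\<lambda>x. x * t) ` {0..1} = {0..t}"
    using image_mult_atLeastAtMost[of t 0 1] assms by (simp add: mult.commute)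
  have "((\<lambda>s. (s / t) powr p * (1 - s / t) powr (\<beta> - 1)) has_integral t * Beta (p + 1) \<beta>) {0..t}"
    using has_integral_affinity[of "\<lambda>x. x powr p * (1 - x) powr (\<beta> - 1)" "Beta (p + 1) \<beta>" 0 1 "1/t" 0] * im assms
    by (simp add: divide_simps mult.commute)
  then have "((\<lambda>s. t powr (p + \<beta> - 1) * ((s / t) powr p * (1 - s / t) powr (\<beta> - 1))) has_integral
      t powr (p + \<beta> - 1) * (t * Beta (p + 1) \<beta>)) {0..t}"
    by (rule has_integral_mult_right)
  moreover have "t powr (p + \<beta> - 1) * (t * Beta (p + 1) \<beta>) =
      t powr (p + \<beta>) * Gamma \<beta> * Gamma (p + 1) / Gamma (p + \<beta> + 1)"
    using assms by (simp add: Beta_def powr_diff field_simps add.commute add.left_commute)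
  moreover have "t powr (p + \<beta> - 1) * ((s / t) powr p * (1 - s / t) powr (\<beta> - 1)) =
      (t - s) powr (\<beta> - 1) * s powr p" if "s \<in> {0..t}" for s
  proof -
    have "1 - s / t = (t - s) / t" using assms by (simp add: field_simps)
    then show ?thesis
      using that assms powr_add[of t p "\<beta> - 1"] by (simp add: powr_divide add_diff_eq)
  qed
  ultimately show ?thesis by (metis (no_types, lifting) has_integral_eq)
qed

text \<open>For \<beta> < 1 the kernel is unbounded at s = t. It is still absolutely integrable,
  being nonnegative with a finite integral, and the continuous factor is bounded and
  measurable.\<close>

lemma integrable_Abel_kernel:
  fixes f :: "real \<Rightarrow> real"
  assumes "0 < \<beta>" "continuous_on {0..t} f"
  shows "(\<lambda>s. (t - s) powr (\<beta> - 1) * f s) integrable_on {0..t}"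
proof (cases "0 < t")
  case True
  have "(\<lambda>s. (t - s) powr (\<beta> - 1)) integrable_on {0..t}"
  proof -
    \<comment> \<open>\<open>s powr 0\<close> is 1 except at s = 0, where it is 0; hence the spike
      at that point.\<close>
    have "(\<lambda>s. (t - s) powr (\<beta> - 1) * s powr 0) integrable_on {0..t}"
      using has_integral_Abel_kernel_powr[OF True assms(1), of 0] by blast
    then show ?thesis
      by (rule integrable_spike_finite[of "{0}", rotated 2]) auto
  qed
  then have "(\<lambda>s. (t - s) powr (\<beta> - 1)) absolutely_integrable_on {0..t}"
    by (rule nonnegative_absolutely_integrable_1) auto
  moreover have "bounded (f ` {0..t})"
    using assms(2) compact_continuous_image compact_imp_bounded by blast
  moreover have "f \<in> borel_measurable (lebesgue_on {0..t})"
    using assms(2) by (intro continuous_imp_measurable_on_sets_lebesgue) auto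
  ultimately have "(\<lambda>s. f s * (t - s) powr (\<beta> - 1)) absolutely_integrable_on {0..t}"
    by (intro absolutely_integrable_bounded_measurable_product_real) auto
  then show ?thesis
    using set_lebesgue_integral_eq_integral(1) by (simp add: mult.commute)
next
  case False
  then have "t < 0 \<or> t = 0" by auto
  then show ?thesis using integrable_on_refl[of _ "0::real"] by auto
qed

lemma rl_integral_sum:
  assumes "0 \<le> \<beta>" "finite I" "\<And>i. i \<in> I \<Longrightarrow> continuous_on {0..t} (f i)"
  shows "rl_integral \<beta> (\<lambda>s. \<Sum>i\<in>I. c i * f i s) t = (\<Sum>i\<in>I. c i * rl_integral \<beta> (f i) t)"
proof (cases "\<beta> = 0")
  case False
  have "integral {0..t} (\<lambda>s. (t - s) powr (\<beta> - 1) * (\<Sum>i\<in>I. c i * f i s)) =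
      integral {0..t} (\<lambda>s. \<Sum>i\<in>I. c i * ((t - s) powr (\<beta> - 1) * f i s))"
    by (simp add: sum_distrib_left mult_ac)
  also have "\<dots> = (\<Sum>i\<in>I. c i * integral {0..t} (\<lambda>s. (t - s) powr (\<beta> - 1) * f i s))"
    using assms False
    by (subst integral_sum) (auto intro!: integrable_on_mult_right integrable_Abel_kernel)
  finally show ?thesis using False by (simp add: rl_integral_def sum_divide_distrib)
qed (simp add: rl_integral_def)

lemma rl_integral_cong:
  assumes "\<And>s. 0 \<le> s \<Longrightarrow> s < T \<Longrightarrow> f s = g s" "0 \<le> t" "t < T"
  shows "rl_integral \<beta> f t = rl_integral \<beta> g t"
  using assms unfolding rl_integral_def
  by (auto intro!: arg_cong2[where f = "(/)"] integral_cong)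

section \<open>Linearity and locality of the Caputo derivative\<close>

text \<open>Taylor coefficients, fractional integral and outer derivatives are each linear. The
  regularity of the summands gives linearity of the Taylor coefficients and integrability against
  the kernel.\<close>

lemma has_caputo_deriv_sum:
  assumes "finite I" "0 < k" "\<alpha> \<le> real k" "0 \<le> t"
    and reg: "\<And>i. i \<in> I \<Longrightarrow> hdiff (k - 1) (f i)" "\<And>i. i \<in> I \<Longrightarrow> continuous_on {0..} (hderiv (k - 1) (f i))"
    and cap: "\<And>i. i \<in> I \<Longrightarrow> has_caputo_deriv k \<alpha> (f i) (D i) t"
  shows "has_caputo_deriv k \<alpha> (\<lambda>s. \<Sum>i\<in>I. c i * f i s) (\<Sum>i\<in>I. c i * D i) t"
proof -
  let ?F = "\<lambda>s. \<Sum>i\<in>I. c i * f i s"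
  let ?w = "\<lambda>f s. f s - (\<Sum>j<k. hderiv j f 0 / fact j * s ^ j)"
  let ?g = "\<lambda>f. rl_integral (real k - \<alpha>) (?w f)"
  let ?G = "\<lambda>s. \<Sum>i\<in>I. c i * ?g (f i) s"
  have hs: "hderiv j ?F 0 = (\<Sum>i\<in>I. c i * hderiv j (f i) 0)" if "j < k" for j
    using hderiv_sum[of I "k - 1" f j 0 c] reg(1) that by auto
  have w: "?w ?F s = (\<Sum>i\<in>I. c i * ?w (f i) s)" for s
  proof -
    have "(\<Sum>j<k. hderiv j ?F 0 / fact j * s ^ j) =
        (\<Sum>j<k. \<Sum>i\<in>I. c i * (hderiv j (f i) 0 / fact j * s ^ j))"
      by (intro sum.cong refl) (simp add: hs sum_distrib_left sum_distrib_right sum_divide_distrib mult_ac)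
    also have "\<dots> = (\<Sum>i\<in>I. c i * (\<Sum>j<k. hderiv j (f i) 0 / fact j * s ^ j))"
      by (subst sum.swap) (simp add: sum_distrib_left)
    finally show ?thesis by (simp add: right_diff_distrib sum_subtractf)
  qed
  have cont: "continuous_on {0..t} (?w (f i))" if "i \<in> I" for i t
    using continuous_on_subset[OF continuous_on_hdiff[OF reg[OF that]], of "{0..t}"]
    by (intro continuous_intros) auto
  have g: "?g ?F s = ?G s" for s
    unfolding w using assms(1,3) cont by (intro rl_integral_sum) auto
  have hd: "hdiff (k - 1) (?g (f i))" if "i \<in> I" for i
    using cap[OF that] by (simp add: has_caputo_deriv_def Let_def)
  have "((\<lambda>s. \<Sum>i\<in>I. c i * hderiv (k - 1) (?g (f i)) s) has_real_derivative (\<Sum>i\<in>I. c i * D i))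
      (at t within {0..})"
    using cap by (intro DERIV_sum DERIV_cmult) (auto simp: has_caputo_deriv_def Let_def)
  then have "(hderiv (k - 1) ?G has_real_derivative (\<Sum>i\<in>I. c i * D i)) (at t within {0..})"
    by (rule has_field_derivative_transform_within[where d = 1])
       (use assms(4) hderiv_sum[of I "k - 1" "\<lambda>i. ?g (f i)" "k - 1" _ c] hd in auto)
  moreover have "hdiff (k - 1) ?G" by (rule hdiff_sum[OF hd])
  moreover have "?g ?F = ?G" using g by (rule ext)
  ultimately show ?thesis by (simp add: has_caputo_deriv_def Let_def)
qed

text \<open>The derivative at \<open>t\<close> depends on the whole past [0, t] and, through the
  outer derivatives, on an arbitrarily short piece beyond \<open>t\<close>. Hence agreement is
  required up to some T > t.\<close>

lemma has_caputo_deriv_cong: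
  assumes eq: "\<And>s. 0 \<le> s \<Longrightarrow> s < T \<Longrightarrow> f s = h s" and "0 < t" "t < T"
    and "has_caputo_deriv k \<alpha> f D t" "has_caputo_deriv k \<alpha> h E t"
  shows "D = E"
proof -
  let ?g = "\<lambda>f. rl_integral (real k - \<alpha>) (\<lambda>s. f s - (\<Sum>j<k. hderiv j f 0 / fact j * s ^ j))"
  have h0: "hderiv j f 0 = hderiv j h 0" for j
    using hderiv_cong[of T f h 0 j] assms by auto
  have g: "?g f s = ?g h s" if "0 \<le> s" "s < T" for s
    using that eq h0 by (intro rl_integral_cong[of T]) auto
  have dg: "hderiv (k - 1) (?g f) s = hderiv (k - 1) (?g h) s" if "0 \<le> s" "s < T" for s
    using that by (intro hderiv_cong[of T] g)
  have "(hderiv (k - 1) (?g f) has_real_derivative D) (at t within {0..})"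
    using assms(4) by (simp add: has_caputo_deriv_def Let_def)
  then have "(hderiv (k - 1) (?g h) has_real_derivative D) (at t within {0..})"
    using assms(2,3) dg
    by (elim has_field_derivative_transform_within[where d = "T - t"]) (auto simp: dist_real_def)
  moreover have "(hderiv (k - 1) (?g h) has_real_derivative E) (at t within {0..})"
    using assms(5) by (simp add: has_caputo_deriv_def Let_def)
  moreover have "at t within {0..} \<noteq> bot" using halfline_nontrivial_limit assms(2) by simp
  ultimately have "vector_derivative (hderiv (k - 1) (?g h)) (at t within {0..}) = D"
      "vector_derivative (hderiv (k - 1) (?g h)) (at t within {0..}) = E"
    by (auto intro!: vector_derivative_within simp: has_real_derivative_iff_has_vector_derivative
        simp del: vector_derivative_within)
  then show ?thesis by (rule trans[OF sym])
qed

section \<open>Mittag-Leffler type series\<close>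

text \<open>The Gamma integral is cut down to [R, R + 1], where the integrand is at least the
  left-hand side.\<close>

lemma Gamma_plus1_ge:
  fixes R x :: real
  assumes "0 < R" "0 \<le> x"
  shows "R powr x * exp (- (R + 1)) \<le> Gamma (x + 1)"
proof -
  have G: "((\<lambda>t. t powr (x + 1 - 1) / exp t) has_integral Gamma (x + 1)) {0..}"
    using assms by (intro Gamma_integral_real) auto
  then have int: "(\<lambda>t. t powr x / exp t) integrable_on {0..}" by (auto simp: integrable_on_def)
  have int': "(\<lambda>t. t powr x / exp t) integrable_on {R..R + 1}"
    using assms by (intro integrable_continuous_interval continuous_intros) auto
  have "R powr x * exp (- (R + 1)) = integral {R..R + 1} (\<lambda>t. R powr x * exp (- (R + 1)))"
    by simp
  also have "\<dots> \<le> integral {R..R + 1} (\<lambda>t. t powr x / exp t)"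
  proof (rule integral_le[OF _ int'])
    fix t assume t: "t \<in> {R..R + 1}"
    have "R powr x * exp (- (R + 1)) \<le> t powr x * exp (- t)"
      using t assms by (intro mult_mono powr_mono2) auto
    then show "R powr x * exp (- (R + 1)) \<le> t powr x / exp t" by (simp add: exp_minus field_simps)
  qed auto
  also have "\<dots> \<le> integral {0..} (\<lambda>t. t powr x / exp t)"
    using assms by (intro integral_subset_le int int') auto
  also have "\<dots> = Gamma (x + 1)" using G by (simp add: integral_unique)
  finally show ?thesis .
qed

text \<open>For constant \<open>a = 1\<close> this is the two-parameter Mittag-Leffler function with
  parameters \<alpha> and \<gamma> + 1. The variable \<open>z\<close> stands for t powr \<alpha>,
  which makes it an ordinary power series.\<close>

definition ml_series :: "(nat \<Rightarrow> real) \<Rightarrow> real \<Rightarrow> real \<Rightarrow> real \<Rightarrow> real" where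
  "ml_series a \<alpha> \<gamma> z = (\<Sum>l. a l / Gamma (\<alpha> * real l + \<gamma> + 1) * z ^ l)"

text \<open>The growth of the entries of matrix powers; the Gamma denominators then make the series
  converge everywhere.\<close>

definition geom_bounded :: "(nat \<Rightarrow> real) \<Rightarrow> bool" where
  "geom_bounded a \<longleftrightarrow> (\<exists>M r. \<forall>l. \<bar>a l\<bar> \<le> M * r ^ l)"

lemma geom_boundedE:
  assumes "geom_bounded a"
  obtains M r where "0 \<le> M" "0 < r" "\<And>l. \<bar>a l\<bar> \<le> M * r ^ l"
proof -
  obtain M r where *: "\<bar>a l\<bar> \<le> M * r ^ l" for l using assms by (auto simp: geom_bounded_def)
  have "\<bar>a l\<bar> \<le> \<bar>M\<bar> * (\<bar>r\<bar> + 1) ^ l" for l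
  proof -
    have "M * r ^ l \<le> \<bar>M\<bar> * \<bar>r\<bar> ^ l" by (metis abs_ge_self abs_mult power_abs)
    also have "\<dots> \<le> \<bar>M\<bar> * (\<bar>r\<bar> + 1) ^ l" by (intro mult_left_mono power_mono) auto
    finally show ?thesis using * order_trans by blast
  qed
  then show ?thesis by (intro that[of "\<bar>M\<bar>" "\<bar>r\<bar> + 1"]) auto
qed

lemma geom_bounded_Suc:
  assumes "geom_bounded a"
  shows "geom_bounded (\<lambda>l. a (Suc l))"
proof -
  obtain M r where "\<bar>a l\<bar> \<le> M * r ^ l" for l using assms by (auto simp: geom_bounded_def)
  then have "\<bar>a (Suc l)\<bar> \<le> (M * r) * r ^ l" for l by (metis mult.assoc power_Suc)
  then show ?thesis unfolding geom_bounded_def by blast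
qed

text \<open>Since \<open>\<Gamma>(x + 1)\<close> exceeds every exponential \<open>R\<^sup>x\<close> up to a constant factor, the terms
  are dominated by a geometric series once \<open>R\<^sup>\<alpha>\<close> is large.\<close>

lemma summable_ml:
  assumes "geom_bounded a" "0 < \<alpha>" "0 \<le> \<gamma>"
  shows "summable (\<lambda>l. norm (a l / Gamma (\<alpha> * real l + \<gamma> + 1) * z ^ l))"
proof -
  obtain M r where M: "0 \<le> M" "0 < r" "\<And>l. \<bar>a l\<bar> \<le> M * r ^ l"
    using geom_boundedE[OF assms(1)] by blast
  \<comment> \<open>The factor 2 produces the ratio 1/2 of the majorant, the summand 1 keeps
    \<open>q\<close> positive when z = 0, and \<open>R\<close> is the number whose power \<alpha> is
    \<open>q\<close>.\<close>
  define q where "q = 2 * r * (\<bar>z\<bar> + 1)"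
  define R where "R = q powr (1 / \<alpha>)"
  have q: "0 < q" using M by (simp add: q_def)
  then have R: "0 < R" "R powr \<alpha> = q" using assms by (auto simp: R_def powr_powr)
  define K where "K = M / (R powr \<gamma> * exp (- (R + 1)))"
  have "norm (a l / Gamma (\<alpha> * real l + \<gamma> + 1) * z ^ l) \<le> K * (1 / 2) ^ l" for l
  proof -
    have "R powr (\<alpha> * real l + \<gamma>) = q ^ l * R powr \<gamma>"
      using R q by (simp add: powr_add powr_powr[symmetric] powr_realpow)
    then have G: "q ^ l * R powr \<gamma> * exp (- (R + 1)) \<le> Gamma (\<alpha> * real l + \<gamma> + 1)"
      using Gamma_plus1_ge[OF R(1), of "\<alpha> * real l + \<gamma>"] assms by simp
    have pos: "0 < q ^ l * R powr \<gamma> * exp (- (R + 1))" using q R by simp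
    have "norm (a l / Gamma (\<alpha> * real l + \<gamma> + 1) * z ^ l) =
        \<bar>a l\<bar> * \<bar>z\<bar> ^ l / Gamma (\<alpha> * real l + \<gamma> + 1)"
      using G pos by (simp add: abs_mult power_abs)
    also have "\<dots> \<le> (M * r ^ l) * (\<bar>z\<bar> + 1) ^ l / (q ^ l * R powr \<gamma> * exp (- (R + 1)))"
      using G pos M by (intro frac_le mult_mono power_mono) auto
    also have "\<dots> = K * (1 / 2) ^ l"
    proof -
      have "q ^ l = 2 ^ l * (r ^ l * (\<bar>z\<bar> + 1) ^ l)" by (simp add: q_def power_mult_distrib)
      moreover have "r ^ l * (\<bar>z\<bar> + 1) ^ l \<noteq> 0" using M(2) by auto
      ultimately show ?thesis using M(2) by (simp add: K_def power_one_over)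
    qed
    finally show ?thesis .
  qed
  moreover have "summable (\<lambda>l. K * (1 / 2) ^ l)"
    by (intro summable_mult summable_geometric) simp
  ultimately show ?thesis
    by (intro summable_norm_comparison_test[of _ "\<lambda>l. K * (1 / 2) ^ l"] exI[of _ 0] allI impI)
qed

lemmas summable_ml' = summable_norm_cancel[OF summable_ml]

text \<open>Separates the Taylor part of a free component from its remainder: with z = t powr
  \<alpha>, the tail carries an extra factor t powr \<alpha> and has \<gamma> raised by
  \<alpha>.\<close>

lemma ml_series_Suc:
  assumes "geom_bounded a" "0 < \<alpha>" "0 \<le> \<gamma>"
  shows "ml_series a \<alpha> \<gamma> z = a 0 / Gamma (\<gamma> + 1) + z * ml_series (\<lambda>l. a (Suc l)) \<alpha> (\<alpha> + \<gamma>) z"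
proof -
  have "ml_series a \<alpha> \<gamma> z =
      (\<Sum>l. a (Suc l) / Gamma (\<alpha> * real (Suc l) + \<gamma> + 1) * z ^ Suc l) + a 0 / Gamma (\<gamma> + 1)"
    unfolding ml_series_def using suminf_split_head[OF summable_ml'[OF assms, of z]] by simp
  also have "(\<Sum>l. a (Suc l) / Gamma (\<alpha> * real (Suc l) + \<gamma> + 1) * z ^ Suc l) =
      (\<Sum>l. z * (a (Suc l) / Gamma (\<alpha> * real l + (\<alpha> + \<gamma>) + 1) * z ^ l))"
    by (intro suminf_cong) (simp add: algebra_simps)
  also have "\<dots> = z * ml_series (\<lambda>l. a (Suc l)) \<alpha> (\<alpha> + \<gamma>) z"
    unfolding ml_series_def
    using assms geom_bounded_Suc by (intro suminf_mult summable_ml') auto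
  finally show ?thesis by simp
qed

lemma ml_series_deriv:
  assumes "geom_bounded a" "0 < \<alpha>" "0 \<le> \<gamma>"
  shows "(ml_series a \<alpha> \<gamma> has_real_derivative
    (\<Sum>l. diffs (\<lambda>l. a l / Gamma (\<alpha> * real l + \<gamma> + 1)) l * z ^ l)) (at z)"
  unfolding ml_series_def[abs_def]
  using termdiffs_strong_converges_everywhere[of "\<lambda>l. a l / Gamma (\<alpha> * real l + \<gamma> + 1)" z]
    summable_ml'[OF assms] by blast

lemma isCont_ml_series: "geom_bounded a \<Longrightarrow> 0 < \<alpha> \<Longrightarrow> 0 \<le> \<gamma> \<Longrightarrow> isCont (ml_series a \<alpha> \<gamma>) z"
  using ml_series_deriv DERIV_isCont by blast

text \<open>Term l is a multiple of t powr (\<alpha> l + \<gamma>) divided by the matching Gamma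
  value, so integration and differentiation change only \<gamma>. As \<open>0 powr 0 = 0\<close>,
  the value at t = 0 is 0 even for \<gamma> = 0.\<close>

definition ml_fun :: "(nat \<Rightarrow> real) \<Rightarrow> real \<Rightarrow> real \<Rightarrow> real \<Rightarrow> real" where
  "ml_fun a \<alpha> \<gamma> t = t powr \<gamma> * ml_series a \<alpha> \<gamma> (t powr \<alpha>)"

lemma continuous_on_ml_series_powr:
  assumes "geom_bounded a" "0 < \<alpha>" "0 \<le> \<gamma>"
  shows "continuous_on {0..} (\<lambda>t. ml_series a \<alpha> \<gamma> (t powr \<alpha>))"
proof (rule continuous_on_compose2[of UNIV "ml_series a \<alpha> \<gamma>"])
  show "continuous_on UNIV (ml_series a \<alpha> \<gamma>)"
    using isCont_ml_series[OF assms] by (simp add: continuous_on_eq_continuous_at)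
  show "continuous_on {0..} (\<lambda>t. t powr \<alpha>)"
    using assms by (intro continuous_on_powr') auto
qed auto

lemma continuous_on_ml_fun:
  assumes "geom_bounded a" "0 < \<alpha>" "0 < \<gamma>"
  shows "continuous_on {0..} (ml_fun a \<alpha> \<gamma>)"
  unfolding ml_fun_def[abs_def] using assms
  by (intro continuous_on_mult continuous_on_powr' continuous_on_ml_series_powr) auto

text \<open>Termwise, the exponent \<alpha> l + \<gamma> comes down as a factor and cancels against
  \<Gamma>(x + 1) = x \<Gamma>(x). The condition \<gamma> \<ge> 1 keeps the new parameter
  nonnegative.\<close>

lemma ml_fun_has_derivative_pos:
  assumes a: "geom_bounded a" "0 < \<alpha>" and \<gamma>: "1 \<le> \<gamma>" and t: "0 < t"
  shows "(ml_fun a \<alpha> \<gamma> has_real_derivative ml_fun a \<alpha> (\<gamma> - 1) t) (at t)"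
proof -
  let ?c = "\<lambda>l. a l / Gamma (\<alpha> * real l + \<gamma> + 1)"
  let ?z = "t powr \<alpha>"
  let ?P' = "\<Sum>l. diffs ?c l * ?z ^ l"
  have g0: "0 \<le> \<gamma>" using \<gamma> by simp
  have "((\<lambda>t. t powr \<gamma> * ml_series a \<alpha> \<gamma> (t powr \<alpha>)) has_real_derivative
      t powr \<gamma> * (?P' * (\<alpha> * t powr (\<alpha> - 1))) + \<gamma> * t powr (\<gamma> - 1) * ml_series a \<alpha> \<gamma> ?z) (at t)"
    by (rule DERIV_mult' has_real_derivative_powr DERIV_chain2[OF ml_series_deriv] assms g0 t)+
  moreover have "t powr \<gamma> * (?P' * (\<alpha> * t powr (\<alpha> - 1))) + \<gamma> * t powr (\<gamma> - 1) * ml_series a \<alpha> \<gamma> ?z =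
      t powr (\<gamma> - 1) * (\<alpha> * (?z * ?P') + \<gamma> * ml_series a \<alpha> \<gamma> ?z)"
    using t by (simp add: powr_diff field_simps)
  \<comment> \<open>The operator \<alpha> z d/dz + \<gamma> multiplies coefficient l by \<alpha> l +
    \<gamma>, the factor that the Gamma recurrence removes.\<close>
  moreover have "\<alpha> * (?z * ?P') + \<gamma> * ml_series a \<alpha> \<gamma> ?z = ml_series a \<alpha> (\<gamma> - 1) ?z"
  proof -
    have s: "summable (\<lambda>l. ?c l * z ^ l)" for z by (rule summable_ml'[OF a g0])
    have "summable (\<lambda>l. diffs ?c l * ?z ^ l)"
      by (rule termdiff_converges_all[OF s])
    then have "(\<lambda>l. real l * ?c l * ?z ^ (l - Suc 0)) sums ?P'"
      by (rule diffs_equiv)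
    then have "(\<lambda>l. \<alpha> * (?z * (real l * ?c l * ?z ^ (l - Suc 0)))) sums (\<alpha> * (?z * ?P'))"
      by (intro sums_mult)
    moreover have "(\<lambda>l. \<gamma> * (?c l * ?z ^ l)) sums (\<gamma> * ml_series a \<alpha> \<gamma> ?z)"
      unfolding ml_series_def by (intro sums_mult summable_sums s)
    ultimately have "(\<lambda>l. \<alpha> * (?z * (real l * ?c l * ?z ^ (l - Suc 0))) + \<gamma> * (?c l * ?z ^ l)) sums
        (\<alpha> * (?z * ?P') + \<gamma> * ml_series a \<alpha> \<gamma> ?z)"
      by (rule sums_add)
    moreover have "\<alpha> * (?z * (real l * ?c l * ?z ^ (l - Suc 0))) + \<gamma> * (?c l * ?z ^ l) =
        a l / Gamma (\<alpha> * real l + (\<gamma> - 1) + 1) * ?z ^ l" for l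
    proof -
      have p: "0 < \<alpha> * real l + \<gamma>" using assms by (simp add: add_nonneg_pos)
      then have "Gamma (\<alpha> * real l + \<gamma> + 1) = (\<alpha> * real l + \<gamma>) * Gamma (\<alpha> * real l + \<gamma>)"
        by (intro Gamma_plus1) auto
      \<comment> \<open>At l = 0 the truncated exponent \<open>l - Suc 0\<close> is harmless because
        of the factor \<open>real l\<close>.\<close>
      moreover have "?z * (real l * ?c l * ?z ^ (l - Suc 0)) = real l * ?c l * ?z ^ l"
        by (cases l) auto
      ultimately show ?thesis
        using p Gamma_real_pos[OF p] by (simp add: divide_simps) (simp add: algebra_simps)
    qed
    ultimately show ?thesis unfolding ml_series_def by (simp add: sums_iff)
  qed
  ultimately show ?thesis by (simp add: ml_fun_def[abs_def])
qed

text \<open>At 0 the difference quotient is h powr (\<gamma> - 1) times a continuous function and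
  tends to 0. The inequality is strict because for \<gamma> = 1 the limit is \<open>a 0\<close>,
  whereas \<open>ml_fun a \<alpha> 0\<close> vanishes at 0.\<close>

lemma ml_fun_has_derivative:
  assumes a: "geom_bounded a" "0 < \<alpha>" and \<gamma>: "1 < \<gamma>" and t: "0 \<le> t"
  shows "(ml_fun a \<alpha> \<gamma> has_real_derivative ml_fun a \<alpha> (\<gamma> - 1) t) (at t within {0..})"
proof (cases "t = 0")
  case False
  then show ?thesis
    using ml_fun_has_derivative_pos[OF a, of \<gamma> t] assms
    by (auto intro: has_field_derivative_at_within)
next
  case True
  have "((\<lambda>h. h powr (\<gamma> - 1) * ml_series a \<alpha> \<gamma> (h powr \<alpha>)) \<longlongrightarrow>
      0 powr (\<gamma> - 1) * ml_series a \<alpha> \<gamma> (0 powr \<alpha>)) (at 0 within {0..})"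
  proof -
    have "continuous_on {0..} (\<lambda>h. h powr (\<gamma> - 1) * ml_series a \<alpha> \<gamma> (h powr \<alpha>))"
      using assms by (intro continuous_on_mult continuous_on_powr' continuous_on_ml_series_powr) auto
    then show ?thesis unfolding continuous_on_def by (rule bspec) simp
  qed
  then have "((\<lambda>h. (ml_fun a \<alpha> \<gamma> h - ml_fun a \<alpha> \<gamma> 0) / (h - 0)) \<longlongrightarrow> 0) (at 0 within {0..})"
    by (rule Lim_transform_eventually[rotated, THEN tendsto_eq_rhs, rotated])
       (auto simp: ml_fun_def eventually_at_filter powr_diff)
  then show ?thesis
    using True by (simp add: has_field_derivative_iff ml_fun_def)
qed

text \<open>On each term the Abel integral trades \<Gamma>(\<alpha> l + \<gamma> + 1) for
  \<Gamma>(\<alpha> l + \<gamma> + \<beta> + 1). Dominated convergence justifies integrating term by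
  term.\<close>

lemma rl_integral_ml_fun:
  assumes a: "geom_bounded a" "0 < \<alpha>" and "0 \<le> \<beta>" "0 \<le> \<gamma>" "0 \<le> t"
  shows "rl_integral \<beta> (ml_fun a \<alpha> \<gamma>) t = ml_fun a \<alpha> (\<gamma> + \<beta>) t"
proof (cases "\<beta> = 0 \<or> t = 0")
  case True
  then show ?thesis by (auto simp: rl_integral_def ml_fun_def)
next
  case False
  then have \<beta>: "0 < \<beta>" and t: "0 < t" using assms by auto
  let ?c = "\<lambda>l. a l / Gamma (\<alpha> * real l + \<gamma> + 1)"
  let ?d = "\<lambda>l. a l / Gamma (\<alpha> * real l + (\<gamma> + \<beta>) + 1)"
  let ?K = "\<lambda>s. (t - s) powr (\<beta> - 1)"
  let ?S = "\<Sum>l. norm (?c l * (t powr \<alpha>) ^ l)"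
  have "((\<lambda>s. ?K s * ml_fun a \<alpha> \<gamma> s) has_integral
      Gamma \<beta> * (t powr (\<gamma> + \<beta>) * ml_series a \<alpha> (\<gamma> + \<beta>) (t powr \<alpha>))) {0..t}"
  proof (rule has_integral_dominated_convergence)
    show "((\<lambda>s. \<Sum>l<k. ?K s * (s powr \<gamma> * (?c l * (s powr \<alpha>) ^ l))) has_integral
      (\<Sum>l<k. Gamma \<beta> * (t powr (\<gamma> + \<beta>) * (?d l * (t powr \<alpha>) ^ l)))) {0..t}" for k
    proof (intro has_integral_sum finite_lessThan)
      fix l
      let ?p = "\<alpha> * real l + \<gamma>"
      have p: "0 \<le> ?p" using assms by simp
      have "((\<lambda>s. ?c l * (?K s * s powr ?p)) has_integral
          ?c l * (t powr (?p + \<beta>) * Gamma \<beta> * Gamma (?p + 1) / Gamma (?p + \<beta> + 1))) {0..t}"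
        by (intro has_integral_mult_right has_integral_Abel_kernel_powr t \<beta> p)
      moreover have "?c l * (t powr (?p + \<beta>) * Gamma \<beta> * Gamma (?p + 1) / Gamma (?p + \<beta> + 1)) =
          Gamma \<beta> * (t powr (\<gamma> + \<beta>) * (?d l * (t powr \<alpha>) ^ l))"
      proof -
        have "t powr (?p + \<beta>) = t powr (\<gamma> + \<beta>) * (t powr \<alpha>) ^ l"
          using t by (simp add: powr_add powr_powr[symmetric] powr_realpow)
        moreover have "0 < ?p + 1" using p by linarith
        then have "Gamma (?p + 1) \<noteq> 0" by (intro less_imp_neq[THEN not_sym] Gamma_real_pos)
        ultimately show ?thesis by (simp add: add.assoc)
      qed
      ultimately have "((\<lambda>s. ?c l * (?K s * s powr ?p)) has_integral
          Gamma \<beta> * (t powr (\<gamma> + \<beta>) * (?d l * (t powr \<alpha>) ^ l))) {0..t}" by simp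
      then show "((\<lambda>s. ?K s * (s powr \<gamma> * (?c l * (s powr \<alpha>) ^ l))) has_integral
          Gamma \<beta> * (t powr (\<gamma> + \<beta>) * (?d l * (t powr \<alpha>) ^ l))) {0..t}"
      proof (rule has_integral_spike_finite[where S = "{0}", rotated 2])
        fix s assume "s \<in> {0..t} - {0}"
        then have "s powr ?p = s powr \<gamma> * (s powr \<alpha>) ^ l"
          by (simp add: powr_add powr_powr[symmetric] powr_realpow)
        then show "?K s * (s powr \<gamma> * (?c l * (s powr \<alpha>) ^ l)) = ?c l * (?K s * s powr ?p)" by simp
      qed simp
    qed
    \<comment> \<open>The absolute values of the terms increase with \<open>s\<close>, so their
      total at the endpoint \<open>t\<close> bounds all partial sums. The factor 1 only matches the
      shape of \<open>integrable_Abel_kernel\<close>.\<close>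
    show "(\<lambda>s. t powr \<gamma> * ?S * (?K s * 1)) integrable_on {0..t}"
      by (intro integrable_on_mult_right integrable_Abel_kernel \<beta>) simp
    show "\<forall>s\<in>{0..t}. norm (\<Sum>l<k. ?K s * (s powr \<gamma> * (?c l * (s powr \<alpha>) ^ l)))
        \<le> t powr \<gamma> * ?S * (?K s * 1)" for k
    proof
      fix s assume s: "s \<in> {0..t}"
      have "norm (\<Sum>l<k. ?c l * (s powr \<alpha>) ^ l) \<le> (\<Sum>l<k. norm (?c l * (t powr \<alpha>) ^ l))"
      proof (rule sum_norm_le)
        fix l
        have "(s powr \<alpha>) ^ l \<le> (t powr \<alpha>) ^ l" using s assms by (intro power_mono powr_mono2) auto
        then show "norm (?c l * (s powr \<alpha>) ^ l) \<le> norm (?c l * (t powr \<alpha>) ^ l)"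
          by (auto intro!: divide_right_mono mult_left_mono simp: abs_mult)
      qed
      also have "\<dots> \<le> ?S" using summable_ml[OF a assms(4)] by (intro sum_le_suminf) auto
      finally have S: "norm (\<Sum>l<k. ?c l * (s powr \<alpha>) ^ l) \<le> ?S" .
      have "(\<Sum>l<k. ?K s * (s powr \<gamma> * (?c l * (s powr \<alpha>) ^ l))) =
          ?K s * (s powr \<gamma> * (\<Sum>l<k. ?c l * (s powr \<alpha>) ^ l))"
        by (simp add: sum_distrib_left)
      then have "norm (\<Sum>l<k. ?K s * (s powr \<gamma> * (?c l * (s powr \<alpha>) ^ l))) =
          ?K s * (s powr \<gamma> * norm (\<Sum>l<k. ?c l * (s powr \<alpha>) ^ l))"
        by (simp only: norm_mult) simp
      also have "\<dots> \<le> ?K s * (t powr \<gamma> * ?S)"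
        using s S assms by (intro mult_left_mono mult_mono powr_mono2) auto
      finally show "norm (\<Sum>l<k. ?K s * (s powr \<gamma> * (?c l * (s powr \<alpha>) ^ l)))
        \<le> t powr \<gamma> * ?S * (?K s * 1)" by (simp add: mult_ac)
    qed
    have lim: "(\<lambda>k. \<Sum>l<k. C * (D * (a l / Gamma (\<alpha> * real l + g + 1) * z ^ l))) \<longlonglongrightarrow>
        C * (D * ml_series a \<alpha> g z)" if "0 \<le> g" for C D g z
      unfolding sums_def[symmetric] ml_series_def
      using that by (intro sums_mult summable_sums summable_ml'[OF a])
    show "\<forall>s\<in>{0..t}. (\<lambda>k. \<Sum>l<k. ?K s * (s powr \<gamma> * (?c l * (s powr \<alpha>) ^ l)))
        \<longlonglongrightarrow> ?K s * ml_fun a \<alpha> \<gamma> s"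
      unfolding ml_fun_def using assms by (intro ballI lim)
    show "(\<lambda>k. \<Sum>l<k. Gamma \<beta> * (t powr (\<gamma> + \<beta>) * (?d l * (t powr \<alpha>) ^ l)))
        \<longlonglongrightarrow> Gamma \<beta> * (t powr (\<gamma> + \<beta>) * ml_series a \<alpha> (\<gamma> + \<beta>) (t powr \<alpha>))"
      using assms by (intro lim) auto
  qed
  moreover have "Gamma \<beta> \<noteq> 0" using \<beta> by (intro less_imp_neq[THEN not_sym] Gamma_real_pos)
  ultimately show ?thesis
    using \<beta> by (simp add: rl_integral_def integral_unique ml_fun_def)
qed

section \<open>Solutions of the uncontrolled system\<close>

lemma ml_series_sum:
  assumes "finite I" "\<And>i. i \<in> I \<Longrightarrow> geom_bounded (a i)" "0 < \<alpha>" "0 \<le> \<gamma>"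
  shows "ml_series (\<lambda>l. \<Sum>i\<in>I. c i * a i l) \<alpha> \<gamma> z = (\<Sum>i\<in>I. c i * ml_series (a i) \<alpha> \<gamma> z)"
proof -
  have "(\<lambda>l. \<Sum>i\<in>I. c i * (a i l / Gamma (\<alpha> * real l + \<gamma> + 1) * z ^ l)) sums
      (\<Sum>i\<in>I. c i * ml_series (a i) \<alpha> \<gamma> z)"
    unfolding ml_series_def using assms by (intro sums_sum sums_mult summable_sums summable_ml')
  moreover have "(\<Sum>i\<in>I. c i * (a i l / Gamma (\<alpha> * real l + \<gamma> + 1) * z ^ l)) =
      (\<Sum>i\<in>I. c i * a i l) / Gamma (\<alpha> * real l + \<gamma> + 1) * z ^ l" for l
    by (simp add: sum_distrib_right sum_divide_distrib mult.assoc)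
  ultimately show ?thesis by (simp add: ml_series_def sums_iff)
qed

text \<open>By \<open>ml_series_Suc\<close>, \<open>f\<close> is the monomial
  \<open>a 0 / fact j * t ^ j\<close> plus an \<open>ml_fun\<close> with parameter \<alpha> + j,
  whose derivatives up to order k - 1 keep a positive parameter and so vanish at 0. For the Caputo
  derivative the monomial is subtracted, integration of order k - \<alpha> raises the parameter to k
  + j, and k differentiations lower it to j; what remains is \<open>f\<close> with shifted
  coefficients.\<close>

lemma
  fixes k j :: nat
  assumes a: "geom_bounded a" and k: "0 < k" "real k - 1 < \<alpha>" "\<alpha> \<le> real k" "0 < \<alpha>" and j: "j < k"
  defines "f \<equiv> \<lambda>t. t ^ j * ml_series a \<alpha> (real j) (t powr \<alpha>)"
  shows hdiff_ml: "hdiff (k - 1) f"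
    and continuous_on_hderiv_ml: "continuous_on {0..} (hderiv (k - 1) f)"
    and hderiv_ml_0: "\<And>i. i < k \<Longrightarrow> hderiv i f 0 = (if i = j then a 0 else 0)"
    and has_caputo_deriv_ml: "\<And>t. 0 < t \<Longrightarrow> has_caputo_deriv k \<alpha> f
      (t ^ j * ml_series (\<lambda>l. a (Suc l)) \<alpha> (real j) (t powr \<alpha>)) t"
proof -
  let ?b = "\<lambda>l. a (Suc l)"
  have b: "geom_bounded ?b" using a by (rule geom_bounded_Suc)
  define d where "d i s = (if i \<le> j then a 0 / fact (j - i) * s ^ (j - i) else 0) +
      ml_fun ?b \<alpha> (\<alpha> + real j - real i) s" for i s
  have d0: "d 0 s = f s" if "0 \<le> s" for s
  proof -
    have "f s = s ^ j * (a 0 / fact j + s powr \<alpha> * ml_series ?b \<alpha> (\<alpha> + real j) (s powr \<alpha>))"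
      unfolding f_def using Gamma_fact[of j, where 'a = real]
      by (subst ml_series_Suc[OF a k(4)]) (simp_all add: add.commute)
    moreover have "s ^ j * s powr \<alpha> = s powr (\<alpha> + real j)"
      using that k by (cases "s = 0") (auto simp: powr_add powr_realpow mult.commute)
    ultimately show ?thesis
      by (simp add: d_def ml_fun_def distrib_left mult.assoc[symmetric])
  qed
  have dS: "(d i has_real_derivative d (Suc i) s) (at s within {0..})" if "i < k - 1" "0 \<le> s" for i s
  proof -
    have "((\<lambda>s. if i \<le> j then a 0 / fact (j - i) * s ^ (j - i) else 0) has_real_derivative
        (if Suc i \<le> j then a 0 / fact (j - Suc i) * s ^ (j - Suc i) else 0)) (at s within {0..})"
    proof (cases "Suc i \<le> j")
      case True
      then have "j - i = Suc (j - Suc i)" by simp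
      then have "fact (j - i) = real (j - i) * fact (j - Suc i)"
        by (metis fact_Suc)
      moreover have "((\<lambda>s. a 0 / fact (j - i) * s ^ (j - i)) has_real_derivative
          a 0 / fact (j - i) * (real (j - i) * s ^ (j - i - Suc 0))) (at s within {0..})"
        by (intro DERIV_cmult DERIV_pow)
      ultimately show ?thesis using True by simp
    qed (cases "i = j"; simp)
    \<comment> \<open>This is where k - 1 < \<alpha> enters: it gives i + 1 < \<alpha> for i < k -
      1, as differentiability at 0 demands.\<close>
    moreover have "1 < \<alpha> + real j - real i" using that k by linarith
    then have "(ml_fun ?b \<alpha> (\<alpha> + real j - real i) has_real_derivative
        ml_fun ?b \<alpha> (\<alpha> + real j - real i - 1) s) (at s within {0..})"
      using that k by (intro ml_fun_has_derivative b)
    ultimately have "((\<lambda>s. (if i \<le> j then a 0 / fact (j - i) * s ^ (j - i) else 0) +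
        ml_fun ?b \<alpha> (\<alpha> + real j - real i) s) has_real_derivative
        (if Suc i \<le> j then a 0 / fact (j - Suc i) * s ^ (j - Suc i) else 0) +
        ml_fun ?b \<alpha> (\<alpha> + real j - real i - 1) s) (at s within {0..})"
      by (rule DERIV_add)
    then show ?thesis by (simp add: d_def[abs_def] diff_diff_eq add.commute)
  qed
  show "hdiff (k - 1) f" by (rule hdiffI[of d, OF d0 dS])
  have hd: "hderiv i f s = d i s" if "i \<le> k - 1" "0 \<le> s" for i s
    by (rule hderiv_eqI[of d, OF d0 dS that])
  have "continuous_on {0..} (d (k - 1))"
  proof -
    have "0 < \<alpha> + real j - real (k - 1)" using k by linarith
    then show ?thesis
      unfolding d_def[abs_def]
      by (intro continuous_on_add continuous_on_ml_fun b k) (cases "k - 1 \<le> j"; simp add: continuous_intros)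
  qed
  then show "continuous_on {0..} (hderiv (k - 1) f)"
    using hd continuous_on_cong[of "{0..}" "{0..}" "hderiv (k - 1) f" "d (k - 1)"] by simp
  show h0: "hderiv i f 0 = (if i = j then a 0 else 0)" if "i < k" for i
    using that hd[of i 0] by (auto simp: d_def ml_fun_def)
  fix t :: real assume t: "0 < t"
  let ?w = "\<lambda>s. f s - (\<Sum>i<k. hderiv i f 0 / fact i * s ^ i)"
  let ?g = "rl_integral (real k - \<alpha>) ?w"
  define e where "e i s = ml_fun ?b \<alpha> (real k + real j - real i) s" for i s
  have w: "?w s = ml_fun ?b \<alpha> (\<alpha> + real j) s" if "0 \<le> s" for s
  proof -
    have "(\<Sum>i<k. hderiv i f 0 / fact i * s ^ i) = (\<Sum>i<k. if i = j then a 0 / fact j * s ^ j else 0)"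
      by (intro sum.cong) (auto simp: h0)
    then show ?thesis using d0[OF that] j by (simp add: d_def)
  qed
  have e0: "e 0 s = ?g s" if "0 \<le> s" for s
  proof -
    have "?g s = rl_integral (real k - \<alpha>) (ml_fun ?b \<alpha> (\<alpha> + real j)) s"
      using that w by (intro rl_integral_cong[of "s + 1"]) auto
    also have "\<dots> = ml_fun ?b \<alpha> (\<alpha> + real j + (real k - \<alpha>)) s"
      using that k by (intro rl_integral_ml_fun b) auto
    finally show ?thesis by (simp add: e_def add.commute)
  qed
  have eS: "(e i has_real_derivative e (Suc i) s) (at s within {0..})" if "i < k - 1" "0 \<le> s" for i s
  proof -
    have "1 < real k + real j - real i" using that k by linarith
    from ml_fun_has_derivative[OF b k(4) this that(2)] show ?thesis
      by (simp add: e_def[abs_def] diff_diff_eq add.commute)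
  qed
  have "hdiff (k - 1) ?g" by (rule hdiffI[of e, OF e0 eS])
  moreover have "(hderiv (k - 1) ?g has_real_derivative
      t ^ j * ml_series ?b \<alpha> (real j) (t powr \<alpha>)) (at t within {0..})"
  \<comment> \<open>For j = 0 the parameter has come down to 1, outside the range of
    \<open>ml_fun_has_derivative\<close>; since t > 0, the rule for positive times applies.\<close>
  proof (rule has_field_derivative_transform_within[where d = 1])
    have "real k + real j - real (k - 1) = 1 + real j" using k by simp
    then have "e (k - 1) = ml_fun ?b \<alpha> (1 + real j)" by (simp only: e_def[abs_def])
    then show "(e (k - 1) has_real_derivative t ^ j * ml_series ?b \<alpha> (real j) (t powr \<alpha>)) (at t within {0..})"
      using ml_fun_has_derivative_pos[OF b k(4), of "1 + real j" t] t
      by (simp add: has_field_derivative_at_within ml_fun_def powr_realpow)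
    show "e (k - 1) s = hderiv (k - 1) ?g s" if "s \<in> {0..}" for s
      using hderiv_eqI[of e ?g "k - 1", OF e0 eS, of "k - 1" s] that by simp
  qed (use t in auto)
  ultimately show "has_caputo_deriv k \<alpha> f
      (t ^ j * ml_series ?b \<alpha> (real j) (t powr \<alpha>)) t"
    by (simp add: has_caputo_deriv_def Let_def)
qed

section \<open>Matrix powers and the free response\<close>

text \<open>The sum \<open>S\<close> of all absolute entries bounds each column sum, so one more
  factor of \<open>A\<close> costs at most a factor \<open>S\<close>.\<close>

lemma geom_bounded_pow_mat:
  fixes A :: "real mat"
  assumes A: "A \<in> carrier_mat n n" and "p < n" "q < n"
  shows "geom_bounded (\<lambda>l. (A ^\<^sub>m l) $$ (p, q))"
proof -
  define S where "S = (\<Sum>r<n. \<Sum>q<n. \<bar>A $$ (r, q)\<bar>)"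
  have S0: "0 \<le> S" unfolding S_def by (intro sum_nonneg) auto
  have "\<bar>(A ^\<^sub>m l) $$ (p, q)\<bar> \<le> 1 * S ^ l" if "q < n" for l q
    using that
  proof (induction l arbitrary: q)
    case 0
    then show ?case using A assms(2) by simp
  next
    case (Suc l)
    have "(A ^\<^sub>m Suc l) $$ (p, q) = (\<Sum>r<n. (A ^\<^sub>m l) $$ (p, r) * A $$ (r, q))"
      using A assms(2) Suc.prems by (simp add: scalar_prod_def atLeast0LessThan)
    also have "\<bar>\<dots>\<bar> \<le> (\<Sum>r<n. S ^ l * \<bar>A $$ (r, q)\<bar>)"
      using Suc.IH by (intro order_trans[OF sum_abs] sum_mono) (simp add: abs_mult mult_right_mono)
    also have "\<dots> = S ^ l * (\<Sum>r<n. \<bar>A $$ (r, q)\<bar>)" by (simp add: sum_distrib_left)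
    also have "\<dots> \<le> S ^ l * S"
      unfolding S_def using Suc.prems
      by (intro mult_left_mono sum_mono member_le_sum zero_le_power sum_nonneg) auto
    finally show ?case by (simp add: mult.commute)
  qed
  then show ?thesis using assms(3) unfolding geom_bounded_def by blast
qed

lemma geom_bounded_sum:
  assumes "finite I" "\<And>i. i \<in> I \<Longrightarrow> geom_bounded (a i)"
  shows "geom_bounded (\<lambda>l. \<Sum>i\<in>I. c i * a i l)"
  using assms
proof (induction I rule: finite_induct)
  case empty
  then show ?case unfolding geom_bounded_def by (auto intro!: exI[of _ 0])
next
  case (insert i I)
  have "geom_bounded (a i)" using insert.prems by simp
  then obtain M r where M: "0 \<le> M" "0 < r" "\<And>l. \<bar>a i l\<bar> \<le> M * r ^ l"
    by (rule geom_boundedE) blast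
  have "geom_bounded (\<lambda>l. \<Sum>i\<in>I. c i * a i l)" using insert by simp
  then obtain N s where N: "0 \<le> N" "0 < s" "\<And>l. \<bar>\<Sum>i\<in>I. c i * a i l\<bar> \<le> N * s ^ l"
    by (rule geom_boundedE) blast
  have "\<bar>\<Sum>i\<in>insert i I. c i * a i l\<bar> \<le> (\<bar>c i\<bar> * M + N) * (max r s) ^ l" for l
  proof -
    have "\<bar>\<Sum>i\<in>insert i I. c i * a i l\<bar> \<le> \<bar>c i\<bar> * \<bar>a i l\<bar> + \<bar>\<Sum>i\<in>I. c i * a i l\<bar>"
      using insert.hyps abs_triangle_ineq[of "c i * a i l"] by (simp add: abs_mult)
    also have "\<dots> \<le> \<bar>c i\<bar> * (M * max r s ^ l) + N * max r s ^ l"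
      using M N
      by (intro add_mono mult_left_mono order_trans[OF M(3)] order_trans[OF N(3)] power_mono) auto
    finally show ?thesis by (simp add: algebra_simps)
  qed
  then show ?case unfolding geom_bounded_def by blast
qed

lemma geom_bounded_pow_mat_vec:
  fixes A :: "real mat"
  assumes A: "A \<in> carrier_mat n n" and "p < n" "v \<in> carrier_vec n"
  shows "geom_bounded (\<lambda>l. ((A ^\<^sub>m l) *\<^sub>v v) $ p)"
proof -
  have "(\<lambda>l. ((A ^\<^sub>m l) *\<^sub>v v) $ p) = (\<lambda>l. \<Sum>q<n. v $ q * (A ^\<^sub>m l) $$ (p, q))"
    using assms by (auto simp: scalar_prod_def atLeast0LessThan mult.commute)
  then show ?thesis
    using geom_bounded_sum[of "{..<n}" "\<lambda>q l. (A ^\<^sub>m l) $$ (p, q)" "\<lambda>q. v $ q"]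
      geom_bounded_pow_mat[OF A assms(2)] by simp
qed

text \<open>The recursion of matrix powers multiplies on the right; the state equation needs the new
  factor on the left.\<close>

lemma pow_mat_Suc_mult_vec:
  assumes "A \<in> carrier_mat n n" "v \<in> carrier_vec n"
  shows "(A ^\<^sub>m Suc l) *\<^sub>v v = A *\<^sub>v ((A ^\<^sub>m l) *\<^sub>v v)"
  using assms
proof (induction l arbitrary: v)
  case (Suc l)
  have "(A ^\<^sub>m Suc (Suc l)) *\<^sub>v v = (A ^\<^sub>m Suc l) *\<^sub>v (A *\<^sub>v v)"
    using Suc.prems by (auto intro: assoc_mult_mat_vec)
  also have "\<dots> = A *\<^sub>v ((A ^\<^sub>m l) *\<^sub>v (A *\<^sub>v v))" using Suc by (intro Suc.IH) auto
  also have "(A ^\<^sub>m l) *\<^sub>v (A *\<^sub>v v) = (A ^\<^sub>m Suc l) *\<^sub>v v"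
    using Suc.prems by (auto intro: assoc_mult_mat_vec[symmetric])
  finally show ?case .
qed (auto simp: assoc_mult_mat_vec)

text \<open>The free response: the sum of t^j \<open>Phi \<alpha> A j t\<close> applied to
  \<open>V j\<close>, with the vectors moved inside the series so that each component is a sum of
  scalar series.\<close>

definition free_state :: "nat \<Rightarrow> real \<Rightarrow> real mat \<Rightarrow> (nat \<Rightarrow> real vec) \<Rightarrow> real \<Rightarrow> real vec" where
  "free_state k \<alpha> A V t = vec (dim_row A) (\<lambda>p. \<Sum>j<k.
     t ^ j * ml_series (\<lambda>l. ((A ^\<^sub>m l) *\<^sub>v V j) $ p) \<alpha> (real j) (t powr \<alpha>))"

text \<open>Linear functionals pass to the coefficients. Rows of \<open>A\<close> give the
  right-hand side of the state equation, rows of \<open>C\<close> the output.\<close>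

lemma sum_free_state:
  assumes A: "A \<in> carrier_mat n n" and V: "\<And>j. j < k \<Longrightarrow> V j \<in> carrier_vec n" and "0 < \<alpha>"
  shows "(\<Sum>p<n. c p * free_state k \<alpha> A V t $ p) = (\<Sum>j<k.
    t ^ j * ml_series (\<lambda>l. \<Sum>p<n. c p * ((A ^\<^sub>m l) *\<^sub>v V j) $ p) \<alpha> (real j) (t powr \<alpha>))"
proof -
  have "(\<Sum>p<n. c p * free_state k \<alpha> A V t $ p) = (\<Sum>p<n. \<Sum>j<k.
      t ^ j * (c p * ml_series (\<lambda>l. ((A ^\<^sub>m l) *\<^sub>v V j) $ p) \<alpha> (real j) (t powr \<alpha>)))"
    using A by (simp add: free_state_def sum_distrib_left mult.left_commute)
  also have "\<dots> = (\<Sum>j<k. t ^ j *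
      (\<Sum>p<n. c p * ml_series (\<lambda>l. ((A ^\<^sub>m l) *\<^sub>v V j) $ p) \<alpha> (real j) (t powr \<alpha>)))"
    by (subst sum.swap) (simp add: sum_distrib_left)
  also have "\<dots> = (\<Sum>j<k. t ^ j *
      ml_series (\<lambda>l. \<Sum>p<n. c p * ((A ^\<^sub>m l) *\<^sub>v V j) $ p) \<alpha> (real j) (t powr \<alpha>))"
    using assms
    by (intro sum.cong refl arg_cong2[where f = "(*)"] ml_series_sum[symmetric] finite_lessThan
        geom_bounded_pow_mat_vec[OF A]) auto
  finally show ?thesis .
qed

text \<open>The Caputo derivative replaces the coefficient A^l v by A^(l+1) v = A (A^l v), which is
  multiplication of the state by \<open>A\<close>.\<close>

lemma caputo_solution_free_state:
  assumes A: "A \<in> carrier_mat n n" and B: "B \<in> carrier_mat n m"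
    and V: "\<And>j. j < k \<Longrightarrow> V j \<in> carrier_vec n"
    and k: "0 < k" "real k - 1 < \<alpha>" "\<alpha> \<le> real k" "0 < \<alpha>"
  shows "caputo_solution k \<alpha> A B (\<lambda>_. 0\<^sub>v m) V (free_state k \<alpha> A V)"
proof -
  let ?x = "free_state k \<alpha> A V"
  let ?a = "\<lambda>p j l. ((A ^\<^sub>m l) *\<^sub>v V j) $ p"
  let ?f = "\<lambda>p j t. t ^ j * ml_series (?a p j) \<alpha> (real j) (t powr \<alpha>)"
  \<comment> \<open>The factor 1 gives the shape of a linear combination, to which the rules for
    sums apply.\<close>
  have x: "(\<lambda>t. ?x t $ p) = (\<lambda>t. \<Sum>j<k. 1 * ?f p j t)" if "p < n" for p
    using A that by (simp add: free_state_def)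
  have gb: "geom_bounded (?a p j)" if "p < n" "j < k" for p j
    using A V that by (intro geom_bounded_pow_mat_vec) auto
  have hd: "hdiff (k - 1) (?f p j)" if "p < n" "j < k" for p j
    by (rule hdiff_ml[OF gb k]) (use that in auto)
  have cont: "continuous_on {0..} (hderiv (k - 1) (?f p j))" if "p < n" "j < k" for p j
    by (rule continuous_on_hderiv_ml[OF gb k]) (use that in auto)
  have hs: "hderiv i (\<lambda>t. ?x t $ p) s = (\<Sum>j<k. hderiv i (?f p j) s)"
    if "i \<le> k - 1" "0 \<le> s" "p < n" for i s p
    unfolding x[OF that(3)] using hderiv_sum[of "{..<k}" "k - 1" "?f p" i s "\<lambda>_. 1"] hd that by simp
  have "?x \<tau> \<in> carrier_vec (dim_row A)" for \<tau> using A by (simp add: free_state_def)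
  moreover have "hdiff (k - 1) (\<lambda>\<tau>. ?x \<tau> $ p)" if "p < n" for p
    unfolding x[OF that] using hd that by (intro hdiff_sum) auto
  moreover have "continuous_on {0..} (hderiv (k - 1) (\<lambda>\<tau>. ?x \<tau> $ p))" if "p < n" for p
  proof -
    have "continuous_on {0..} (\<lambda>s. \<Sum>j<k. hderiv (k - 1) (?f p j) s)"
      using cont that by (intro continuous_on_sum) auto
    then show ?thesis
      using continuous_on_cong[of "{0..}" "{0..}" "hderiv (k - 1) (\<lambda>\<tau>. ?x \<tau> $ p)"] hs that by simp
  qed
  moreover have "hderiv j (\<lambda>\<tau>. ?x \<tau> $ p) 0 = V j $ p" if "p < n" "j < k" for p j
  proof -
    have "hderiv j (\<lambda>\<tau>. ?x \<tau> $ p) 0 = (\<Sum>i<k. if j = i then ?a p i 0 else 0)"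
      using that by (subst hs) (auto intro!: sum.cong simp: hderiv_ml_0[OF gb k])
    also have "\<dots> = V j $ p" using that A V by simp
    finally show ?thesis .
  qed
  moreover have "has_caputo_deriv k \<alpha> (\<lambda>s. ?x s $ p) ((A *\<^sub>v ?x \<tau> + B *\<^sub>v 0\<^sub>v m) $ p) \<tau>"
    if "0 < \<tau>" "p < n" for p \<tau>
  proof -
    have "has_caputo_deriv k \<alpha> (\<lambda>t. \<Sum>j<k. 1 * ?f p j t)
        (\<Sum>j<k. 1 * (\<tau> ^ j * ml_series (\<lambda>l. ?a p j (Suc l)) \<alpha> (real j) (\<tau> powr \<alpha>))) \<tau>"
      using k that hd cont by (intro has_caputo_deriv_sum has_caputo_deriv_ml gb) auto
    moreover have "?a p j (Suc l) = (\<Sum>q<n. A $$ (p, q) * ?a q j l)" if "j < k" for j l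
    proof -
      have "?a p j (Suc l) = (A *\<^sub>v ((A ^\<^sub>m l) *\<^sub>v V j)) $ p"
        using pow_mat_Suc_mult_vec[OF A V[OF that], of l] by simp
      then show ?thesis using A \<open>p < n\<close> by (simp add: scalar_prod_def atLeast0LessThan)
    qed
    moreover have "(A *\<^sub>v ?x \<tau> + B *\<^sub>v 0\<^sub>v m) $ p = (\<Sum>q<n. A $$ (p, q) * ?x \<tau> $ q)"
      using A B that by (simp add: scalar_prod_def atLeast0LessThan free_state_def)
    ultimately show ?thesis
      unfolding x[OF that(2)] using sum_free_state[OF A V k(4), where c = "\<lambda>q. A $$ (p, q)" and t = \<tau>] by simp
  qed
  ultimately show ?thesis using A B by (simp add: caputo_solution_def)
qed

section \<open>Unobservable vectors\<close>

text \<open>Requiring all powers makes invariance under \<open>A\<close> immediate; the reduction to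
  finitely many powers is proved separately. The scalars are generic because real and complex
  matrices both occur.\<close>

definition unobservable :: "'a::comm_ring_1 mat \<Rightarrow> 'a mat \<Rightarrow> 'a vec \<Rightarrow> bool" where
  "unobservable A C v \<longleftrightarrow> v \<in> carrier_vec (dim_row A) \<and>
     (\<forall>l. C *\<^sub>v ((A ^\<^sub>m l) *\<^sub>v v) = 0\<^sub>v (dim_row C))"

lemma unobservable_zero:
  assumes A: "A \<in> carrier_mat n n" and C: "C \<in> carrier_mat z n"
  shows "unobservable A C (0\<^sub>v n)"
proof -
  have M0: "M *\<^sub>v 0\<^sub>v n = 0\<^sub>v r" if "M \<in> carrier_mat r n" for M :: "'a mat" and r
    using that by (intro eq_vecI) auto
  show ?thesis
    using A C M0[OF pow_carrier_mat[OF A]] M0[OF C] by (simp add: unobservable_def)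
qed

lemma mult_free_state_unobservable:
  assumes A: "A \<in> carrier_mat n n" and C: "C \<in> carrier_mat z n" and "0 < \<alpha>"
    and V: "\<And>j. j < k \<Longrightarrow> unobservable A C (V j)"
  shows "C *\<^sub>v free_state k \<alpha> A V t = 0\<^sub>v z"
proof (rule eq_vecI)
  fix i assume "i < dim_vec (0\<^sub>v z :: real vec)"
  then have i: "i < z" by simp
  have V': "V j \<in> carrier_vec n" if "j < k" for j using V[OF that] A by (simp add: unobservable_def)
  have "(C *\<^sub>v free_state k \<alpha> A V t) $ i = (\<Sum>p<n. C $$ (i, p) * free_state k \<alpha> A V t $ p)"
    using C A i by (simp add: scalar_prod_def atLeast0LessThan free_state_def)
  also have "\<dots> = (\<Sum>j<k. t ^ j *
      ml_series (\<lambda>l. \<Sum>p<n. C $$ (i, p) * ((A ^\<^sub>m l) *\<^sub>v V j) $ p) \<alpha> (real j) (t powr \<alpha>))"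
    by (rule sum_free_state[OF A V' assms(3)])
  also have "\<dots> = 0"
  proof (rule sum.neutral, intro ballI)
    fix j assume j: "j \<in> {..<k}"
    have "(\<Sum>p<n. C $$ (i, p) * ((A ^\<^sub>m l) *\<^sub>v V j) $ p) = 0" for l
    proof -
      have "(C *\<^sub>v ((A ^\<^sub>m l) *\<^sub>v V j)) $ i = 0"
        using V[of j] j i C by (simp add: unobservable_def del: index_mult_mat_vec)
      then show ?thesis using A C i by (simp add: scalar_prod_def atLeast0LessThan)
    qed
    then show "t ^ j * ml_series (\<lambda>l. \<Sum>p<n. C $$ (i, p) * ((A ^\<^sub>m l) *\<^sub>v V j) $ p)
        \<alpha> (real j) (t powr \<alpha>) = 0" by (simp add: ml_series_def)
  qed
  finally show "(C *\<^sub>v free_state k \<alpha> A V t) $ i = 0\<^sub>v z $ i" using i by simp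
qed (use C in simp)

lemma admissible_control_zero: "admissible_control m (\<lambda>_. 0\<^sub>v m)"
proof -
  have "piecewise_continuous (\<lambda>_. c)" for c
    unfolding piecewise_continuous_def by (auto intro: tendsto_const)
  then show ?thesis
    by (auto simp: admissible_control_def intro!: finite_imp_bounded finite_subset[of _ "{0}"])
qed

text \<open>With zero control, the free responses to \<open>v\<close> in all k slots and to 0 both
  have zero output.\<close>

lemma observable_imp_unobservable_zero:
  assumes A: "A \<in> carrier_mat n n" and B: "B \<in> carrier_mat n m" and C: "C \<in> carrier_mat z n"
    and k: "0 < k" "real k - 1 < \<alpha>" "\<alpha> \<le> real k" "0 < \<alpha>"
    and obs: "observable k \<alpha> A B C t" and v: "unobservable A C v"
  shows "v = 0\<^sub>v n"
proof -
  have vc: "v \<in> carrier_vec n" using v A by (simp add: unobservable_def)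
  note 0 = unobservable_zero[OF A C]
  let ?x = "\<lambda>w. free_state k \<alpha> A (\<lambda>_. w)"
  have sol: "caputo_solution k \<alpha> A B (\<lambda>_. 0\<^sub>v (dim_col B)) (\<lambda>_. w) (?x w)"
    if "w \<in> carrier_vec n" for w
    using caputo_solution_free_state[OF A B that k] B by simp
  have "C *\<^sub>v ?x v \<tau> = C *\<^sub>v ?x (0\<^sub>v n) \<tau>" for \<tau>
    using mult_free_state_unobservable[OF A C k(4)] v 0 by simp
  then have "\<forall>j<k. v = 0\<^sub>v n"
    using obs[unfolded observable_def, THEN spec, THEN spec, THEN spec, THEN spec, THEN spec,
        of "\<lambda>_. 0\<^sub>v (dim_col B)" "\<lambda>_. v" "\<lambda>_. 0\<^sub>v n" "?x v" "?x (0\<^sub>v n)"]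
      admissible_control_zero[of "dim_col B"] sol[OF vc] sol[OF zero_carrier_vec] vc A by simp
  then show ?thesis using k(1) by blast
qed

section \<open>From equal outputs to unobservable differences\<close>

lemma continuous_zero_off_finite:
  fixes h :: "real \<Rightarrow> real"
  assumes "continuous_on {0..t} h" "finite F" "0 < t"
    and zero: "\<And>s. 0 < s \<Longrightarrow> s < t \<Longrightarrow> s \<notin> F \<Longrightarrow> h s = 0" and s: "s \<in> {0..t}"
  shows "h s = 0"
proof -
  let ?S = "{0<..<t} - F"
  have lim: "x islimpt ?S" if "x \<in> {0..t}" for x
  proof -
    have "\<And>y. {0..t} \<noteq> {y}"
      using assms(3) by (metis atLeastAtMost_iff less_eq_real_def not_less_iff_gr_or_eq singletonD)
    then have "x islimpt {0..t}" by (intro connected_imp_perfect that) auto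
    moreover have "{0..t} \<subseteq> (F \<union> {0, t}) \<union> ?S" by auto
    ultimately have "x islimpt (F \<union> {0, t}) \<union> ?S" by (rule islimpt_subset)
    then show ?thesis using islimpt_Un_finite[of "F \<union> {0, t}" x ?S] assms(2) by blast
  qed
  have "closure ?S \<subseteq> {0..t}" by (rule closure_minimal) auto
  then have "continuous_on (closure ?S) h" using assms(1) continuous_on_subset by blast
  moreover have "s \<in> closure ?S" using lim[OF s] by (simp add: closure_def)
  ultimately show ?thesis using zero by (intro continuous_constant_on_closure[of ?S h 0 s]) auto
qed

lemma caputo_solutionD:
  assumes "caputo_solution k \<alpha> A B u x0 x"
  shows "\<And>s. 0 \<le> s \<Longrightarrow> x s \<in> carrier_vec (dim_row A)"
    and "\<And>i. i < dim_row A \<Longrightarrow> hdiff (k - 1) (\<lambda>s. x s $ i)"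
    and "\<And>i. i < dim_row A \<Longrightarrow> continuous_on {0..} (hderiv (k - 1) (\<lambda>s. x s $ i))"
    and "\<And>i j. i < dim_row A \<Longrightarrow> j < k \<Longrightarrow> hderiv j (\<lambda>s. x s $ i) 0 = x0 j $ i"
    and "\<And>s i. 0 < s \<Longrightarrow> (\<And>l. l < dim_col B \<Longrightarrow> isCont (\<lambda>s. u s $ l) s) \<Longrightarrow> i < dim_row A \<Longrightarrow>
      has_caputo_deriv k \<alpha> (\<lambda>s. x s $ i) ((A *\<^sub>v x s + B *\<^sub>v u s) $ i) s"
  using assms unfolding caputo_solution_def by blast+

text \<open>If the row vector \<open>c\<close> does not separate two states on \<open>[0, t]\<close>, neither does \<open>c A\<close>: compare the
  Caputo derivatives of \<open>c x\<close> and \<open>c x'\<close>, where the contributions of the control cancel.\<close>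

lemma indistinguishable_step:
  assumes A: "A \<in> carrier_mat n n" and B: "B \<in> carrier_mat n m"
    and k: "0 < k" "\<alpha> \<le> real k" and t: "0 < t"
    and u: "admissible_control m u"
    and x: "caputo_solution k \<alpha> A B u x0 x" and x': "caputo_solution k \<alpha> A B u x0' x'"
    and c: "c \<in> carrier_vec n" and eq: "\<And>s. s \<in> {0..t} \<Longrightarrow> c \<bullet> x s = c \<bullet> x' s"
    and s: "s \<in> {0..t}"
  shows "(transpose_mat A *\<^sub>v c) \<bullet> x s = (transpose_mat A *\<^sub>v c) \<bullet> x' s"
proof -
  let ?D = "\<lambda>y \<tau> i. (A *\<^sub>v y \<tau> + B *\<^sub>v u \<tau>) $ i"
  define F where "F = (\<Union>l<m. {\<tau> \<in> {0..t}. \<not> continuous (at \<tau> within {0..}) (\<lambda>s. u s $ l)})"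
  have F: "finite F"
    using u unfolding F_def by (auto simp: admissible_control_def piecewise_continuous_def)
  have carr: "y s \<in> carrier_vec n" if "caputo_solution k \<alpha> A B u y0 y" "0 \<le> s" for y y0 s
    using that A by (simp add: caputo_solution_def)
  have sp: "w \<bullet> y = (\<Sum>i<n. w $ i * y $ i)" if "y \<in> carrier_vec n" for w y :: "real vec"
    using that by (auto simp: scalar_prod_def atLeast0LessThan)
  have adj: "(transpose_mat A *\<^sub>v c) \<bullet> y = c \<bullet> (A *\<^sub>v y)" if "y \<in> carrier_vec n" for y
    by (rule transpose_vec_mult_scalar[OF A that c])
  have cap: "has_caputo_deriv k \<alpha> (\<lambda>s. \<Sum>i<n. c $ i * y s $ i) (\<Sum>i<n. c $ i * ?D y \<tau> i) \<tau>"
    if y: "caputo_solution k \<alpha> A B u y0 y" and \<tau>: "0 < \<tau>" "\<tau> < t" "\<tau> \<notin> F" for y y0 \<tau>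
  proof -
    have "isCont (\<lambda>s. u s $ l) \<tau>" if "l < m" for l
    proof -
      \<comment> \<open>Piecewise continuity refers to the half-line, the state equation to
        two-sided continuity; for \<tau> > 0 they agree.\<close>
      have "at \<tau> within {0..} = at \<tau>"
        using \<tau>(1) by (intro at_within_interior) (simp add: interior_real_atLeast)
      moreover have "continuous (at \<tau> within {0..}) (\<lambda>s. u s $ l)"
        using \<tau> that by (auto simp: F_def)
      ultimately show ?thesis by simp
    qed
    then show ?thesis
      using \<tau>(1) A B k by (intro has_caputo_deriv_sum caputo_solutionD[OF y]) auto
  qed
  have cont: "continuous_on {0..t} (\<lambda>s. (transpose_mat A *\<^sub>v c) \<bullet> y s)"
    if y: "caputo_solution k \<alpha> A B u y0 y" for y y0
  proof -
    have "continuous_on {0..} (\<lambda>s. y s $ i)" if "i < n" for i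
      by (rule continuous_on_hdiff[of "k - 1"]; rule caputo_solutionD[OF y]) (use that A in simp_all)
    then have "continuous_on {0..t} (\<lambda>s. y s $ i)" if "i < n" for i
      by (rule continuous_on_subset) (use that in auto)
    then have "continuous_on {0..t} (\<lambda>s. \<Sum>i<n. (transpose_mat A *\<^sub>v c) $ i * y s $ i)"
      by (intro continuous_on_sum continuous_on_mult_left) auto
    then show ?thesis
      by (rule continuous_on_eq) (use sp[OF carr[OF y]] in auto)
  qed
  have zero: "(transpose_mat A *\<^sub>v c) \<bullet> x \<tau> - (transpose_mat A *\<^sub>v c) \<bullet> x' \<tau> = 0"
    if \<tau>: "0 < \<tau>" "\<tau> < t" "\<tau> \<notin> F" for \<tau>
  proof -
    have "(\<Sum>i<n. c $ i * ?D x \<tau> i) = (\<Sum>i<n. c $ i * ?D x' \<tau> i)"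
    \<comment> \<open>Since \<tau> < t, agreement on [0, t) reaches beyond \<tau>.\<close>
    proof (rule has_caputo_deriv_cong[OF _ \<tau>(1,2) cap[OF x \<tau>] cap[OF x' \<tau>]])
      fix s assume "0 \<le> s" "s < t"
      then show "(\<Sum>i<n. c $ i * x s $ i) = (\<Sum>i<n. c $ i * x' s $ i)"
        using eq[of s] sp[OF carr[OF x]] sp[OF carr[OF x']] by simp
    qed
    moreover have "(\<Sum>i<n. c $ i * ?D y \<tau> i) =
        c \<bullet> (A *\<^sub>v y \<tau>) + (\<Sum>i<n. c $ i * (B *\<^sub>v u \<tau>) $ i)"
      if "y \<tau> \<in> carrier_vec n" for y
    proof -
      have "?D y \<tau> i = (A *\<^sub>v y \<tau>) $ i + (B *\<^sub>v u \<tau>) $ i" if "i < n" for i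
        using that A B by (intro index_add_vec) simp
      moreover have "A *\<^sub>v y \<tau> \<in> carrier_vec n" by (rule mult_mat_vec_carrier[OF A that])
      ultimately show ?thesis
        by (simp add: sp distrib_left sum.distrib del: index_mult_mat_vec index_add_vec)
    qed
    ultimately have "c \<bullet> (A *\<^sub>v x \<tau>) = c \<bullet> (A *\<^sub>v x' \<tau>)"
      using carr[OF x] carr[OF x'] \<tau>(1) by simp
    then show ?thesis using adj carr[OF x] carr[OF x'] \<tau>(1) by simp
  qed
  have "(transpose_mat A *\<^sub>v c) \<bullet> x s - (transpose_mat A *\<^sub>v c) \<bullet> x' s = 0"
    by (rule continuous_zero_off_finite[OF continuous_on_diff[OF cont[OF x] cont[OF x']] F t zero s])
  then show ?thesis by simp
qed

text \<open>Equality on [0, t] with t > 0 fixes the one-sided derivatives at 0 of the scalar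
  function c x, and these are c applied to the initial vectors.\<close>

lemma indistinguishable_initial:
  assumes A: "A \<in> carrier_mat n n" and k: "0 < k" and t: "0 < t"
    and x: "caputo_solution k \<alpha> A B u x0 x" and x': "caputo_solution k \<alpha> A B u x0' x'"
    and c: "c \<in> carrier_vec n" and eq: "\<And>s. s \<in> {0..t} \<Longrightarrow> c \<bullet> x s = c \<bullet> x' s"
    and j: "j < k" and x0: "x0 j \<in> carrier_vec n" "x0' j \<in> carrier_vec n"
  shows "c \<bullet> x0 j = c \<bullet> x0' j"
proof -
  have sp: "w \<bullet> y = (\<Sum>i<n. w $ i * y $ i)" if "y \<in> carrier_vec n" for w y :: "real vec"
    using that by (auto simp: scalar_prod_def atLeast0LessThan)
  have carr: "y s \<in> carrier_vec n" if "caputo_solution k \<alpha> A B u y0 y" "0 \<le> s" for y y0 s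
    using that A by (simp add: caputo_solution_def)
  have h: "hderiv j (\<lambda>s. \<Sum>i<n. c $ i * y s $ i) 0 = (\<Sum>i<n. c $ i * y0 j $ i)"
    if "caputo_solution k \<alpha> A B u y0 y" for y y0
    using that A j hderiv_sum[of "{..<n}" "k - 1" "\<lambda>i s. y s $ i" j 0 "\<lambda>i. c $ i"]
      caputo_solutionD(2,4)[OF that] by simp
  have "hderiv j (\<lambda>s. \<Sum>i<n. c $ i * x s $ i) 0 = hderiv j (\<lambda>s. \<Sum>i<n. c $ i * x' s $ i) 0"
    using eq t sp[OF carr[OF x]] sp[OF carr[OF x']] by (intro hderiv_cong[of t]) auto
  then show ?thesis using h[OF x] h[OF x'] sp x0 by simp
qed

lemma unobservable_zero_imp_observable:
  assumes A: "A \<in> carrier_mat n n" and B: "B \<in> carrier_mat n m" and C: "C \<in> carrier_mat z n"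
    and k: "0 < k" "\<alpha> \<le> real k" and t: "0 < t"
    and triv: "\<And>v. unobservable A C v \<Longrightarrow> v = 0\<^sub>v n"
  shows "observable k \<alpha> A B C t"
  unfolding observable_def
proof (intro allI impI, elim conjE)
  fix u x0 x0' x x' j
  assume u: "admissible_control (dim_col B) u"
    and x0: "\<forall>j<k. x0 j \<in> carrier_vec (dim_row A) \<and> x0' j \<in> carrier_vec (dim_row A)"
    and x: "caputo_solution k \<alpha> A B u x0 x" and x': "caputo_solution k \<alpha> A B u x0' x'"
    and eq: "\<forall>\<tau>\<in>{0..t}. C *\<^sub>v x \<tau> = C *\<^sub>v x' \<tau>" and j: "j < k"
  have um: "admissible_control m u" using u B by simp
  have x0c: "x0 j \<in> carrier_vec n" "x0' j \<in> carrier_vec n" using x0 j A by auto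
  define d where "d = x0 j - x0' j"
  have dc: "d \<in> carrier_vec n" using x0c by (simp add: d_def)
  have "unobservable A C d"
    unfolding unobservable_def
  proof (intro conjI allI)
    fix l
    show "C *\<^sub>v ((A ^\<^sub>m l) *\<^sub>v d) = 0\<^sub>v (dim_row C)"
    proof (rule eq_vecI)
      fix i assume "i < dim_vec (0\<^sub>v (dim_row C) :: real vec)"
      then have i: "i < z" using C by simp
      \<comment> \<open>The row vector c A^l for the row c = \<open>row C i\<close>, obtained by
        iterating \<open>indistinguishable_step\<close>.\<close>
      define cs where "cs l = ((*\<^sub>v) (transpose_mat A) ^^ l) (row C i)" for l
      have cs: "cs l \<in> carrier_vec n \<and> (\<forall>s\<in>{0..t}. cs l \<bullet> x s = cs l \<bullet> x' s)" for l
      proof (induction l)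
        case 0
        have "row C i \<bullet> x s = row C i \<bullet> x' s" if "s \<in> {0..t}" for s
        proof -
          have "(C *\<^sub>v x s) $ i = (C *\<^sub>v x' s) $ i" using eq that by simp
          then show ?thesis using i C by simp
        qed
        then show ?case using C i by (auto simp: cs_def)
      next
        case (Suc l)
        then show ?case
          using indistinguishable_step[OF A B k t um x x', of "cs l"] A by (auto simp: cs_def)
      qed
      have adj: "cs l \<bullet> w = row C i \<bullet> ((A ^\<^sub>m l) *\<^sub>v w)" if "w \<in> carrier_vec n" for w l
        using that
      proof (induction l arbitrary: w)
        case (Suc l)
        have "cs (Suc l) \<bullet> w = cs l \<bullet> (A *\<^sub>v w)"
          using transpose_vec_mult_scalar[OF A Suc.prems, of "cs l"] cs[of l] by (simp add: cs_def)
        also have "\<dots> = row C i \<bullet> ((A ^\<^sub>m l) *\<^sub>v (A *\<^sub>v w))" using Suc A by simp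
        also have "(A ^\<^sub>m l) *\<^sub>v (A *\<^sub>v w) = (A ^\<^sub>m Suc l) *\<^sub>v w"
          using Suc.prems A by (auto intro: assoc_mult_mat_vec[symmetric])
        finally show ?case .
      qed (use A in \<open>simp add: cs_def\<close>)
      have "cs l \<bullet> d = cs l \<bullet> x0 j - cs l \<bullet> x0' j"
        unfolding d_def using cs[of l] x0c by (intro scalar_prod_minus_distrib) auto
      also have "\<dots> = 0"
        using indistinguishable_initial[OF A k(1) t x x', of "cs l" j] cs[of l] j x0c by simp
      finally have "row C i \<bullet> ((A ^\<^sub>m l) *\<^sub>v d) = 0" using adj[OF dc] by simp
      then show "(C *\<^sub>v ((A ^\<^sub>m l) *\<^sub>v d)) $ i = 0\<^sub>v (dim_row C) $ i" using i C by simp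
    qed (use C in simp)
  qed (use dc A in simp)
  then have "d = 0\<^sub>v n" by (rule triv)
  then show "x0 j = x0' j"
    using x0c unfolding d_def by (auto simp: vec_eq_iff)
qed

section \<open>The minimal polynomial and the observability matrix\<close>

text \<open>The entry at index 0 of p(S) a, where S is the shift of sequences. For a sequence of
  entries of A^l or A^l v it is the corresponding entry of p(A) or p(A) v, so annihilation can be
  handled on scalar sequences.\<close>

definition seq_apply :: "'a::comm_ring_1 poly \<Rightarrow> (nat \<Rightarrow> 'a) \<Rightarrow> 'a" where
  "seq_apply p a = (\<Sum>l\<le>degree p. coeff p l * a l)"

lemma seq_apply_bound:
  assumes "degree p \<le> N"
  shows "seq_apply p a = (\<Sum>l\<le>N. coeff p l * a l)"
  unfolding seq_apply_def using assms
  by (intro sum.mono_neutral_left) (auto simp: coeff_eq_0)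

lemma seq_apply_diff: "seq_apply (p - q) a = seq_apply p a - seq_apply q a"
proof -
  let ?N = "max (degree p) (degree q)"
  have "degree (p - q) \<le> ?N" by (rule degree_diff_le_max)
  then show ?thesis
    by (simp add: seq_apply_bound[of _ ?N] left_diff_distrib sum_subtractf)
qed

lemma seq_apply_smult: "seq_apply (smult c p) a = c * seq_apply p a"
  using seq_apply_bound[OF degree_smult_le, of c p a]
  by (simp add: seq_apply_def sum_distrib_left mult.assoc)

lemma seq_apply_sum: "seq_apply p (\<lambda>l. \<Sum>i\<in>I. c i * a i l) = (\<Sum>i\<in>I. c i * seq_apply p (a i))"
  unfolding seq_apply_def sum_distrib_left
  by (subst sum.swap) (simp add: mult.left_commute)

text \<open>The factor X - \<sigma> acts as shift minus \<sigma>; on the sequence A^l v this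
  replaces v by A v - \<sigma> v.\<close>

lemma seq_apply_linear_factor:
  "seq_apply ([:- \<sigma>, 1:] * q) a = seq_apply q (\<lambda>l. a (Suc l) - \<sigma> * a l)"
proof -
  let ?N = "degree q"
  have p: "[:- \<sigma>, 1:] * q = pCons 0 q - smult \<sigma> q" by simp
  have "seq_apply (pCons 0 q) a = (\<Sum>l\<le>Suc ?N. coeff (pCons 0 q) l * a l)"
    by (rule seq_apply_bound) (simp add: degree_pCons_le)
  also have "\<dots> = (\<Sum>l\<le>?N. coeff q l * a (Suc l))"
    by (subst sum.atMost_Suc_shift) simp
  finally show ?thesis
    unfolding p seq_apply_diff seq_apply_smult
    by (simp add: seq_apply_def right_diff_distrib sum_subtractf sum_distrib_left mult.left_commute)
qed

lemma poly_mat_index: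
  "i < dim_row M \<Longrightarrow> j < dim_row M \<Longrightarrow>
    poly_mat p M $$ (i, j) = seq_apply p (\<lambda>l. (M ^\<^sub>m l) $$ (i, j))"
  by (simp add: poly_mat_def seq_apply_def)

lemma poly_mat_eq_0_iff:
  "poly_mat p M = 0\<^sub>m (dim_row M) (dim_row M) \<longleftrightarrow>
    (\<forall>i<dim_row M. \<forall>j<dim_row M. seq_apply p (\<lambda>l. (M ^\<^sub>m l) $$ (i, j)) = 0)"
  by (auto simp: mat_eq_iff poly_mat_index poly_mat_def[of p M, THEN arg_cong[of _ _ dim_row]]
      poly_mat_def[of p M, THEN arg_cong[of _ _ dim_col]])

lemma block_index_less:
  fixes i j n N :: nat
  assumes "i < N" "j < n"
  shows "i * n + j < N * n"
proof -
  have "i * n + j < Suc i * n" using assms by simp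
  also have "\<dots> \<le> N * n" using assms by (intro mult_le_mono1) simp
  finally show ?thesis .
qed

text \<open>The n^2 + 1 powers up to exponent n^2 lie in a space of dimension n^2. Column l of
  \<open>Q\<close> is the l-th power written out as a vector, and a kernel vector lists the
  coefficients.\<close>

lemma annihilating_poly_exists:
  fixes M :: "'a::field mat"
  assumes M: "M \<in> carrier_mat n n"
  obtains p where "p \<noteq> 0" "poly_mat p M = 0\<^sub>m n n"
proof -
  define Q where "Q = mat (n * n) (Suc (n * n)) (\<lambda>(c, l). (M ^\<^sub>m l) $$ (c div n, c mod n))"
  have Q: "Q \<in> carrier_mat (n * n) (Suc (n * n))" by (simp add: Q_def)
  obtain v where v: "v \<in> carrier_vec (Suc (n * n))" "v \<noteq> 0\<^sub>v (Suc (n * n))" "Q *\<^sub>v v = 0\<^sub>v (n * n)"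
    using wide_matrix_kernel[OF Q] by auto
  define p where "p = (\<Sum>l\<le>n * n. monom (v $ l) l)"
  have c: "coeff p l = (if l \<le> n * n then v $ l else 0)" for l
    by (auto simp: p_def coeff_sum)
  have "p \<noteq> 0"
  proof
    assume "p = 0"
    then have "v $ l = 0" if "l \<le> n * n" for l using c[of l] that by simp
    then show False using v by (auto simp: vec_eq_iff less_Suc_eq_le)
  qed
  moreover have "degree p \<le> n * n" by (rule degree_le) (simp add: c)
  then have s: "seq_apply p a = (\<Sum>l\<le>n * n. v $ l * a l)" for a
    by (simp add: seq_apply_bound c)
  have "poly_mat p M = 0\<^sub>m (dim_row M) (dim_row M)"
    unfolding poly_mat_eq_0_iff
  proof (intro allI impI)
    fix i j assume ij: "i < dim_row M" "j < dim_row M"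
    then have n: "i < n" "j < n" using M by auto
    have lt: "i * n + j < n * n" using n by (rule block_index_less)
    have "(Q *\<^sub>v v) $ (i * n + j) = 0" using v(3) lt by simp
    then have "(\<Sum>l<Suc (n * n). (M ^\<^sub>m l) $$ (i, j) * v $ l) = 0"
      using lt n v(1) by (simp add: Q_def scalar_prod_def atLeast0LessThan)
    then show "seq_apply p (\<lambda>l. (M ^\<^sub>m l) $$ (i, j)) = 0"
      unfolding s lessThan_Suc_atMost by (simp add: mult.commute)
  qed
  ultimately show ?thesis using that M by auto
qed

text \<open>Shows that the definite description in \<open>minimal_poly\<close> denotes. A nonzero
  annihilator of least degree is normalised; the difference of two such monic polynomials
  annihilates and has smaller degree, so it is 0.\<close>

lemma
  fixes M :: "'a::field mat"
  assumes M: "M \<in> carrier_mat n n"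
  shows monic_minimal_poly: "monic (minimal_poly M)"
    and poly_mat_minimal_poly: "poly_mat (minimal_poly M) M = 0\<^sub>m n n"
proof -
  define ann where "ann p \<longleftrightarrow> poly_mat p M = 0\<^sub>m (dim_row M) (dim_row M)" for p
  define is_min where "is_min p \<longleftrightarrow> monic p \<and> ann p \<and> (\<forall>q. q \<noteq> 0 \<and> ann q \<longrightarrow> degree p \<le> degree q)" for p
  have ann_smult: "ann (smult c p)" if "ann p" for c p
    using that by (simp add: ann_def poly_mat_eq_0_iff seq_apply_smult)
  have ann_diff: "ann (p - q)" if "ann p" "ann q" for p q
    using that by (simp add: ann_def poly_mat_eq_0_iff seq_apply_diff)
  have "\<exists>p. p \<noteq> 0 \<and> ann p" using annihilating_poly_exists[OF M] M by (metis ann_def carrier_matD(1))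
  then obtain p where p: "p \<noteq> 0" "ann p" "\<And>q. q \<noteq> 0 \<and> ann q \<Longrightarrow> degree p \<le> degree q"
    using ex_has_least_nat[of "\<lambda>p. p \<noteq> 0 \<and> ann p" _ degree] by blast
  define p0 where "p0 = smult (inverse (lead_coeff p)) p"
  have min0: "is_min p0"
    using p ann_smult by (simp add: is_min_def p0_def)
  have "q = p0" if "is_min q" for q
  proof (rule ccontr)
    assume "q \<noteq> p0"
    then have ne: "q - p0 \<noteq> 0" by simp
    have deg: "degree q = degree p0"
      using that min0 by (metis is_min_def le_antisym leading_coeff_0_iff zero_neq_one)
    have "degree (q - p0) \<le> degree p0" using degree_diff_le_max[of q p0] deg by simp
    moreover have "coeff (q - p0) (degree p0) = 0" using that min0 deg by (simp add: is_min_def)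
    ultimately have "degree (q - p0) < degree p0" using eq_zero_or_degree_less ne by blast
    moreover have "degree p0 \<le> degree (q - p0)"
      using min0 that ne ann_diff by (auto simp: is_min_def)
    ultimately show False by simp
  qed
  then have "(THE p. is_min p) = p0" using min0 by (intro the_equality)
  moreover have "minimal_poly M = (THE p. is_min p)"
    by (simp only: minimal_poly_def is_min_def ann_def)
  ultimately have "minimal_poly M = p0" by simp
  then show "monic (minimal_poly M)" "poly_mat (minimal_poly M) M = 0\<^sub>m n n"
    using min0 M by (auto simp: is_min_def ann_def)
qed

lemma seq_apply_annihilates:
  assumes M: "M \<in> carrier_mat n n" and "poly_mat p M = 0\<^sub>m n n"
    and r: "r \<in> carrier_vec n" and w: "w \<in> carrier_vec n"
  shows "seq_apply p (\<lambda>l. r \<bullet> ((M ^\<^sub>m l) *\<^sub>v w)) = 0"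
proof -
  have "r \<bullet> ((M ^\<^sub>m l) *\<^sub>v w) = (\<Sum>i<n. r $ i * (\<Sum>j<n. w $ j * (M ^\<^sub>m l) $$ (i, j)))" for l
    using M w by (simp add: scalar_prod_def atLeast0LessThan mult.commute)
  moreover have "seq_apply p (\<lambda>l. (M ^\<^sub>m l) $$ (i, j)) = 0" if "i < n" "j < n" for i j
    using assms(2) that M poly_mat_eq_0_iff[of p M] by auto
  ultimately show ?thesis by (simp add: seq_apply_sum)
qed

lemma pow_mat_mult_vec_carrier:
  "A \<in> carrier_mat n n \<Longrightarrow> v \<in> carrier_vec n \<Longrightarrow> (A ^\<^sub>m l) *\<^sub>v v \<in> carrier_vec n"
  by (rule mult_mat_vec_carrier[OF pow_carrier_mat])

lemma pow_mat_add_mult_vec: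
  assumes "A \<in> carrier_mat n n" "v \<in> carrier_vec n"
  shows "(A ^\<^sub>m (l + s)) *\<^sub>v v = (A ^\<^sub>m l) *\<^sub>v ((A ^\<^sub>m s) *\<^sub>v v)"
  using assms
proof (induction l)
  case (Suc l)
  have "(A ^\<^sub>m Suc l) *\<^sub>v ((A ^\<^sub>m s) *\<^sub>v v) = A *\<^sub>v ((A ^\<^sub>m l) *\<^sub>v ((A ^\<^sub>m s) *\<^sub>v v))"
    using Suc.prems by (intro pow_mat_Suc_mult_vec pow_mat_mult_vec_carrier)
  then show ?case
    using Suc pow_mat_Suc_mult_vec[OF Suc.prems, of "l + s"] by simp
qed (simp add: pow_mat_mult_vec_carrier)

text \<open>For each row r of \<open>C\<close>, the monic minimal polynomial makes r A^l v a linear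
  recurrent sequence of order \<mu>, so \<mu> initial zeros propagate.\<close>

lemma unobservable_iff_minimal_poly:
  fixes A C :: "'a::field mat"
  assumes A: "A \<in> carrier_mat n n" and C: "C \<in> carrier_mat z n" and v: "v \<in> carrier_vec n"
  shows "unobservable A C v \<longleftrightarrow>
    (\<forall>l<degree (minimal_poly A). C *\<^sub>v ((A ^\<^sub>m l) *\<^sub>v v) = 0\<^sub>v z)"
proof
  assume *: "\<forall>l<degree (minimal_poly A). C *\<^sub>v ((A ^\<^sub>m l) *\<^sub>v v) = 0\<^sub>v z"
  let ?p = "minimal_poly A" and ?\<mu> = "degree (minimal_poly A)"
  have "row C i \<bullet> ((A ^\<^sub>m l) *\<^sub>v v) = 0" if i: "i < z" for i l
  proof (induction l rule: less_induct)
    case (less l)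
    show ?case
    proof (cases "l < ?\<mu>")
      case True
      then have "(C *\<^sub>v ((A ^\<^sub>m l) *\<^sub>v v)) $ i = 0\<^sub>v z $ i" using * by simp
      then show ?thesis using i C by simp
    next
      case False
      \<comment> \<open>The recurrence is applied to A^s v, so that its leading term has the
        exponent \<mu> + s = l.\<close>
      define s where "s = l - ?\<mu>"
      let ?a = "\<lambda>l. row C i \<bullet> ((A ^\<^sub>m l) *\<^sub>v ((A ^\<^sub>m s) *\<^sub>v v))"
      have a: "?a j = row C i \<bullet> ((A ^\<^sub>m (j + s)) *\<^sub>v v)" for j
        using pow_mat_add_mult_vec[OF A v] by simp
      have "seq_apply ?p ?a = 0"
        using A C i v
        by (intro seq_apply_annihilates[OF A poly_mat_minimal_poly[OF A]] pow_mat_mult_vec_carrier) auto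
      moreover have "seq_apply ?p ?a = (\<Sum>j<?\<mu>. coeff ?p j * ?a j) + ?a ?\<mu>"
        unfolding seq_apply_def using monic_minimal_poly[OF A] by (simp add: lessThan_Suc_atMost[symmetric])
      moreover have "?a j = 0" if "j < ?\<mu>" for j
        unfolding a using that False by (intro less) (simp add: s_def)
      ultimately have "?a ?\<mu> = 0" by simp
      then show ?thesis unfolding a using False by (simp add: s_def)
    qed
  qed
  then show "unobservable A C v"
    using A C v by (auto simp: unobservable_def intro!: eq_vecI)
qed (use C in \<open>auto simp: unobservable_def\<close>)

lemma pow_mat_Suc_left:
  assumes "A \<in> carrier_mat n n"
  shows "A ^\<^sub>m Suc l = A * A ^\<^sub>m l"
proof (induction l)
  case (Suc l)
  have "A ^\<^sub>m Suc (Suc l) = (A * A ^\<^sub>m l) * A" using Suc by simp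
  also have "\<dots> = A * (A ^\<^sub>m l * A)" using assms by (intro assoc_mult_mat) auto
  finally show ?case by simp
qed (use assms in auto)

lemma transpose_pow_mat_index:
  fixes A :: "'a::comm_ring_1 mat"
  assumes A: "A \<in> carrier_mat n n" and C: "C \<in> carrier_mat z n" and "i < n" "q < z"
  shows "((transpose_mat A) ^\<^sub>m l * transpose_mat C) $$ (i, q) = (C * A ^\<^sub>m l) $$ (q, i)"
proof -
  have "(transpose_mat A) ^\<^sub>m l = transpose_mat (A ^\<^sub>m l)" for l
  proof (induction l)
    case (Suc l)
    have "A ^\<^sub>m Suc l = A * A ^\<^sub>m l" by (rule pow_mat_Suc_left[OF A])
    then show ?case using Suc A transpose_mult[OF A pow_carrier_mat[OF A]] by simp
  qed (use A in simp)
  then have "(transpose_mat A) ^\<^sub>m l * transpose_mat C = transpose_mat (C * A ^\<^sub>m l)"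
    using transpose_mult[OF C pow_carrier_mat[OF A]] by simp
  then show ?thesis using assms by simp
qed

text \<open>The transposed block row applied to v stacks the vectors C A^l v, and full row rank says
  that this map is injective.\<close>

lemma rank_observability_matrix:
  fixes A C :: "'a::field mat"
  assumes A: "A \<in> carrier_mat n n" and C: "C \<in> carrier_mat z n"
  shows "vec_space.rank n (block_row n z N (\<lambda>l. (transpose_mat A) ^\<^sub>m l * transpose_mat C)) = n \<longleftrightarrow>
    (\<forall>v\<in>carrier_vec n. (\<forall>l<N. C *\<^sub>v ((A ^\<^sub>m l) *\<^sub>v v) = 0\<^sub>v z) \<longrightarrow> v = 0\<^sub>v n)"
proof -
  let ?M = "block_row n z N (\<lambda>l. (transpose_mat A) ^\<^sub>m l * transpose_mat C)"
  have M: "?M \<in> carrier_mat n (N * z)" by (simp add: block_row_def)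
  have "transpose_mat ?M *\<^sub>v v = 0\<^sub>v (N * z) \<longleftrightarrow> (\<forall>l<N. C *\<^sub>v ((A ^\<^sub>m l) *\<^sub>v v) = 0\<^sub>v z)"
    if v: "v \<in> carrier_vec n" for v
  proof -
    have entry: "(transpose_mat ?M *\<^sub>v v) $ (l * z + q) = (C *\<^sub>v ((A ^\<^sub>m l) *\<^sub>v v)) $ q"
      if "l < N" "q < z" for l q
    proof -
      have lt: "l * z + q < N * z" using that by (rule block_index_less)
      have "C *\<^sub>v ((A ^\<^sub>m l) *\<^sub>v v) = (C * A ^\<^sub>m l) *\<^sub>v v"
        by (rule assoc_mult_mat_vec[symmetric, OF C pow_carrier_mat[OF A] v])
      moreover have "(transpose_mat ?M *\<^sub>v v) $ (l * z + q) = (\<Sum>i<n. ?M $$ (i, l * z + q) * v $ i)"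
        using lt v M by (simp add: scalar_prod_def atLeast0LessThan)
      moreover have "?M $$ (i, l * z + q) = (C * A ^\<^sub>m l) $$ (q, i)" if "i < n" for i
        using lt that \<open>q < z\<close> transpose_pow_mat_index[OF A C] by (simp add: block_row_def)
      moreover have "((C * A ^\<^sub>m l) *\<^sub>v v) $ q = (\<Sum>i<n. (C * A ^\<^sub>m l) $$ (q, i) * v $ i)"
        using that v A C by (simp add: scalar_prod_def atLeast0LessThan del: index_mult_mat(1))
      ultimately show ?thesis by simp
    qed
    show ?thesis
    proof
      assume L: "transpose_mat ?M *\<^sub>v v = 0\<^sub>v (N * z)"
      show "\<forall>l<N. C *\<^sub>v ((A ^\<^sub>m l) *\<^sub>v v) = 0\<^sub>v z"
      proof (intro allI impI eq_vecI)
        fix l q assume lq: "l < N" "q < dim_vec (0\<^sub>v z :: 'a vec)"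
        have "l * z + q < N * z" using lq by (intro block_index_less) simp_all
        then show "(C *\<^sub>v ((A ^\<^sub>m l) *\<^sub>v v)) $ q = 0\<^sub>v z $ q"
          using entry[of l q] lq unfolding L by simp
      qed (use C in simp)
    next
      assume R: "\<forall>l<N. C *\<^sub>v ((A ^\<^sub>m l) *\<^sub>v v) = 0\<^sub>v z"
      show "transpose_mat ?M *\<^sub>v v = 0\<^sub>v (N * z)"
      proof (rule eq_vecI)
        fix c assume "c < dim_vec (0\<^sub>v (N * z) :: 'a vec)"
        then have c: "c < N * z" by simp
        \<comment> \<open>The existence of an index c < N z excludes z = 0, so
          \<open>c div z\<close> and \<open>c mod z\<close> are block number and offset.\<close>
        then have "0 < z" by (cases z) auto
        then have "c div z < N" "c mod z < z" using c by (auto simp: less_mult_imp_div_less)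
        then show "(transpose_mat ?M *\<^sub>v v) $ c = 0\<^sub>v (N * z) $ c"
          using entry[of "c div z" "c mod z"] R c by simp
      qed (use M in simp)
    qed
  qed
  then show ?thesis using rank_eq_dim_row_iff[OF M] by auto
qed

section \<open>The Hautus criterion\<close>

lemma eq_zero_vec_iff: "dim_vec w = z \<Longrightarrow> w = 0\<^sub>v z \<longleftrightarrow> (\<forall>i<z. w $ i = 0)"
  by (auto simp: vec_eq_iff)

text \<open>Multiplication by a real matrix commutes with taking real and imaginary parts. This
  links the real system to its complex spectrum.\<close>

lemma map_mat_unobservable:
  fixes A C :: "real mat"
  assumes A: "A \<in> carrier_mat n n" and C: "C \<in> carrier_mat z n" and v: "v \<in> carrier_vec n"
  shows "unobservable (map_mat complex_of_real A) (map_mat complex_of_real C) v \<longleftrightarrow>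
    unobservable A C (map_vec Re v) \<and> unobservable A C (map_vec Im v)"
proof -
  let ?Ac = "map_mat complex_of_real A" and ?Cc = "map_mat complex_of_real C"
  have M: "map_mat complex_of_real M *\<^sub>v v = 0\<^sub>v z \<longleftrightarrow>
      M *\<^sub>v map_vec Re v = 0\<^sub>v z \<and> M *\<^sub>v map_vec Im v = 0\<^sub>v z" if "M \<in> carrier_mat z n" for M
  proof -
    have "Re ((map_mat complex_of_real M *\<^sub>v v) $ i) = (M *\<^sub>v map_vec Re v) $ i"
      "Im ((map_mat complex_of_real M *\<^sub>v v) $ i) = (M *\<^sub>v map_vec Im v) $ i" if "i < z" for i
      using that v \<open>M \<in> carrier_mat z n\<close> by (auto simp: scalar_prod_def)
    moreover have "(map_mat complex_of_real M *\<^sub>v v) $ i = 0 \<longleftrightarrow>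
      Re ((map_mat complex_of_real M *\<^sub>v v) $ i) = 0 \<and> Im ((map_mat complex_of_real M *\<^sub>v v) $ i) = 0" for i
      by (simp only: complex_eq_iff zero_complex.sel)
    ultimately have "(map_mat complex_of_real M *\<^sub>v v) $ i = 0 \<longleftrightarrow>
        (M *\<^sub>v map_vec Re v) $ i = 0 \<and> (M *\<^sub>v map_vec Im v) $ i = 0" if "i < z" for i
      using that by simp
    then show ?thesis
      using that by (auto simp: eq_zero_vec_iff simp del: index_mult_mat_vec)
  qed
  have 1: "C *\<^sub>v ((A ^\<^sub>m l) *\<^sub>v w) = (C * A ^\<^sub>m l) *\<^sub>v w" if "w \<in> carrier_vec n" for w l
    by (rule assoc_mult_mat_vec[symmetric, OF C pow_carrier_mat[OF A] that])
  have Ac: "?Ac \<in> carrier_mat n n" and Cc: "?Cc \<in> carrier_mat z n" using A C by auto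
  have 2: "?Cc *\<^sub>v ((?Ac ^\<^sub>m l) *\<^sub>v v) = map_mat complex_of_real (C * A ^\<^sub>m l) *\<^sub>v v" for l
    using assoc_mult_mat_vec[symmetric, OF Cc pow_carrier_mat[OF Ac] v]
    by (simp add: of_real_hom.mat_hom_mult[OF C pow_carrier_mat[OF A]] of_real_hom.mat_hom_pow[OF A])
  have 3: "C * A ^\<^sub>m l \<in> carrier_mat z n" for l using A C by (intro mult_carrier_mat) auto
  show ?thesis
    unfolding unobservable_def using A C v by (auto simp: 1 2 M[OF 3])
qed

lemma unobservable_diff_smult:
  fixes A C :: "'a::field mat"
  assumes A: "A \<in> carrier_mat n n" and "unobservable A C v" and C: "C \<in> carrier_mat z n"
  shows "unobservable A C (A *\<^sub>v v - \<sigma> \<cdot>\<^sub>v v)"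
proof -
  have v: "v \<in> carrier_vec n" and z: "C *\<^sub>v ((A ^\<^sub>m l) *\<^sub>v v) = 0\<^sub>v z" for l
    using assms by (auto simp: unobservable_def)
  have Av: "A *\<^sub>v v \<in> carrier_vec n" by (rule mult_mat_vec_carrier[OF A v])
  have "C *\<^sub>v ((A ^\<^sub>m l) *\<^sub>v (A *\<^sub>v v - \<sigma> \<cdot>\<^sub>v v)) = 0\<^sub>v z" for l
  proof -
    have "(A ^\<^sub>m l) *\<^sub>v (A *\<^sub>v v - \<sigma> \<cdot>\<^sub>v v) = (A ^\<^sub>m l) *\<^sub>v (A *\<^sub>v v) - (A ^\<^sub>m l) *\<^sub>v (\<sigma> \<cdot>\<^sub>v v)"
      by (rule mult_minus_distrib_mat_vec[OF pow_carrier_mat[OF A] Av]) (use v in simp)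
    also have "(A ^\<^sub>m l) *\<^sub>v (A *\<^sub>v v) = (A ^\<^sub>m Suc l) *\<^sub>v v"
      using A v by (auto intro: assoc_mult_mat_vec[symmetric])
    also have "(A ^\<^sub>m l) *\<^sub>v (\<sigma> \<cdot>\<^sub>v v) = \<sigma> \<cdot>\<^sub>v ((A ^\<^sub>m l) *\<^sub>v v)"
      by (rule mult_mat_vec[OF pow_carrier_mat[OF A] v])
    also have "C *\<^sub>v ((A ^\<^sub>m Suc l) *\<^sub>v v - \<sigma> \<cdot>\<^sub>v ((A ^\<^sub>m l) *\<^sub>v v)) =
        C *\<^sub>v ((A ^\<^sub>m Suc l) *\<^sub>v v) - C *\<^sub>v (\<sigma> \<cdot>\<^sub>v ((A ^\<^sub>m l) *\<^sub>v v))"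
      by (rule mult_minus_distrib_mat_vec[OF C])
         (intro smult_carrier_vec[THEN iffD2] pow_mat_mult_vec_carrier[OF A v])+
    also have "C *\<^sub>v (\<sigma> \<cdot>\<^sub>v ((A ^\<^sub>m l) *\<^sub>v v)) = \<sigma> \<cdot>\<^sub>v (C *\<^sub>v ((A ^\<^sub>m l) *\<^sub>v v))"
      by (rule mult_mat_vec[OF C pow_mat_mult_vec_carrier[OF A v]])
    finally show ?thesis unfolding z by auto
  qed
  then show ?thesis using A C v Av by (simp add: unobservable_def)
qed

text \<open>An annihilating polynomial \<open>p = (X - \<sigma>) q\<close> of \<open>v\<close> either exhibits \<open>v\<close> as an eigenvector or
  can be replaced by the annihilating polynomial \<open>q\<close> of \<open>A v - \<sigma> v\<close>.\<close>

lemma unobservable_eigenvector: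
  fixes A C :: "complex mat"
  assumes A: "A \<in> carrier_mat n n" and C: "C \<in> carrier_mat z n"
    and "p \<noteq> 0" "unobservable A C v" "v \<noteq> 0\<^sub>v n"
    and "\<And>i. i < n \<Longrightarrow> seq_apply p (\<lambda>l. ((A ^\<^sub>m l) *\<^sub>v v) $ i) = 0"
  shows "\<exists>\<sigma> w. unobservable A C w \<and> w \<noteq> 0\<^sub>v n \<and> A *\<^sub>v w = \<sigma> \<cdot>\<^sub>v w"
  using assms(3-)
proof (induction "degree p" arbitrary: p v)
  case 0
  \<comment> \<open>A nonzero constant annihilates only the zero vector, so this case contradicts v
    being nonzero.\<close>
  have v: "v \<in> carrier_vec n" using 0 A by (simp add: unobservable_def)
  have "coeff p 0 \<noteq> 0" using 0 by (metis leading_coeff_0_iff)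
  moreover have "seq_apply p (\<lambda>l. ((A ^\<^sub>m l) *\<^sub>v v) $ i) = coeff p 0 * v $ i" if "i < n" for i
    using 0(1) A v that by (simp add: seq_apply_def)
  ultimately have "v = 0\<^sub>v n" using 0(5) v by (auto simp: vec_eq_iff)
  then show ?case using 0 by simp
next
  case (Suc d)
  have v: "v \<in> carrier_vec n" using Suc.prems A by (simp add: unobservable_def)
  obtain \<sigma> where "poly p \<sigma> = 0"
    using fundamental_theorem_of_algebra[of p] Suc.hyps(2) by (auto simp: constant_degree)
  then obtain q where q: "p = [:- \<sigma>, 1:] * q" by (auto simp: poly_eq_0_iff_dvd)
  have "q \<noteq> 0" using Suc.prems(1) q by auto
  have "degree p = Suc (degree q)" unfolding q using \<open>q \<noteq> 0\<close> by (subst degree_mult_eq) auto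
  then have dq: "d = degree q" using Suc.hyps(2) by simp
  show ?case
  proof (cases "A *\<^sub>v v = \<sigma> \<cdot>\<^sub>v v")
    case True
    then show ?thesis using Suc.prems by blast
  next
    case False
    define u where "u = A *\<^sub>v v - \<sigma> \<cdot>\<^sub>v v"
    have Av: "A *\<^sub>v v \<in> carrier_vec n" by (rule mult_mat_vec_carrier[OF A v])
    have "u \<noteq> 0\<^sub>v n"
    proof
      assume "u = 0\<^sub>v n"
      then have "(A *\<^sub>v v) $ i - \<sigma> * v $ i = 0" if "i < n" for i
        using that v Av unfolding u_def
        by (metis index_minus_vec(1) index_smult_vec(1) index_smult_vec(2) carrier_vecD index_zero_vec(1))
      then have "A *\<^sub>v v = \<sigma> \<cdot>\<^sub>v v" using v Av A
        by (intro eq_vecI) (auto simp del: index_mult_mat_vec)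
      then show False using False by simp
    qed
    moreover have "unobservable A C u"
      unfolding u_def by (rule unobservable_diff_smult[OF A Suc.prems(2) C])
    moreover have "seq_apply q (\<lambda>l. ((A ^\<^sub>m l) *\<^sub>v u) $ i) = 0" if i: "i < n" for i
    proof -
      have "((A ^\<^sub>m l) *\<^sub>v u) $ i = ((A ^\<^sub>m Suc l) *\<^sub>v v) $ i - \<sigma> * ((A ^\<^sub>m l) *\<^sub>v v) $ i" for l
      proof -
        have "(A ^\<^sub>m l) *\<^sub>v u = (A ^\<^sub>m l) *\<^sub>v (A *\<^sub>v v) - (A ^\<^sub>m l) *\<^sub>v (\<sigma> \<cdot>\<^sub>v v)"
          unfolding u_def
          by (rule mult_minus_distrib_mat_vec[OF pow_carrier_mat[OF A] Av]) (use v in simp)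
        moreover have "(A ^\<^sub>m l) *\<^sub>v (A *\<^sub>v v) = (A ^\<^sub>m Suc l) *\<^sub>v v"
          using A v by (auto intro: assoc_mult_mat_vec[symmetric])
        moreover have "(A ^\<^sub>m l) *\<^sub>v (\<sigma> \<cdot>\<^sub>v v) = \<sigma> \<cdot>\<^sub>v ((A ^\<^sub>m l) *\<^sub>v v)"
          by (rule mult_mat_vec[OF pow_carrier_mat[OF A] v])
        ultimately show ?thesis
          using i A by (simp del: index_mult_mat_vec pow_mat.simps)
      qed
      then show ?thesis
        using Suc.prems(4)[OF i] unfolding q seq_apply_linear_factor by simp
    qed
    ultimately show ?thesis using Suc.hyps(1)[OF dq \<open>q \<noteq> 0\<close>] by blast
  qed
qed

text \<open>An eigenvector killed by \<open>C\<close> is unobservable because A^l v = \<sigma>^l v.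
  Conversely, an eigenvector in the unobservable subspace is killed by \<open>C\<close>, by the case
  l = 0.\<close>

lemma Hautus_criterion:
  fixes A C :: "complex mat"
  assumes A: "A \<in> carrier_mat n n" and C: "C \<in> carrier_mat z n"
  shows "(\<forall>v. unobservable A C v \<longrightarrow> v = 0\<^sub>v n) \<longleftrightarrow>
    (\<forall>\<sigma>\<in>spectrum A. \<forall>v\<in>carrier_vec n. A *\<^sub>v v = \<sigma> \<cdot>\<^sub>v v \<and> C *\<^sub>v v = 0\<^sub>v z \<longrightarrow> v = 0\<^sub>v n)"
    (is "?L \<longleftrightarrow> ?R")
proof
  assume L: ?L
  show ?R
  proof (intro ballI impI, elim conjE)
    fix \<sigma> v assume v: "v \<in> carrier_vec n" and ev: "A *\<^sub>v v = \<sigma> \<cdot>\<^sub>v v" and Cv: "C *\<^sub>v v = 0\<^sub>v z"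
    have pw: "(A ^\<^sub>m l) *\<^sub>v v = \<sigma> ^ l \<cdot>\<^sub>v v" for l
    proof (induction l)
      case (Suc l)
      have "(A ^\<^sub>m Suc l) *\<^sub>v v = A *\<^sub>v (\<sigma> ^ l \<cdot>\<^sub>v v)"
        using pow_mat_Suc_mult_vec[OF A v, of l] Suc by simp
      also have "\<dots> = \<sigma> ^ l \<cdot>\<^sub>v (\<sigma> \<cdot>\<^sub>v v)" using mult_mat_vec[OF A v] ev by simp
      finally show ?case by (simp add: smult_smult_assoc mult.commute)
    qed (use A v in simp)
    have "unobservable A C v"
      unfolding unobservable_def pw using mult_mat_vec[OF C v] Cv v A C by auto
    then show "v = 0\<^sub>v n" using L by blast
  qed
next
  assume R: ?R
  show ?L
  proof (intro allI impI, rule ccontr)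
    fix v assume v: "unobservable A C v" "v \<noteq> 0\<^sub>v n"
    then have vc: "v \<in> carrier_vec n" using A by (simp add: unobservable_def)
    obtain p where p: "p \<noteq> 0" "poly_mat p A = 0\<^sub>m n n" by (rule annihilating_poly_exists[OF A])
    have "seq_apply p (\<lambda>l. ((A ^\<^sub>m l) *\<^sub>v v) $ i) = 0" if "i < n" for i
    proof -
      have "unit_vec n i \<bullet> ((A ^\<^sub>m l) *\<^sub>v v) = ((A ^\<^sub>m l) *\<^sub>v v) $ i" for l
        by (rule scalar_prod_left_unit[OF pow_mat_mult_vec_carrier[OF A vc] that])
      then show ?thesis using seq_apply_annihilates[OF A p(2) unit_vec_carrier vc, of i] by simp
    qed
    then obtain \<sigma> w where w: "unobservable A C w" "w \<noteq> 0\<^sub>v n" "A *\<^sub>v w = \<sigma> \<cdot>\<^sub>v w"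
      using unobservable_eigenvector[OF A C p(1) v] by blast
    then have wc: "w \<in> carrier_vec n" using A by (simp add: unobservable_def)
    have "\<forall>l. C *\<^sub>v ((A ^\<^sub>m l) *\<^sub>v w) = 0\<^sub>v z" using w(1) C by (simp add: unobservable_def)
    then have "C *\<^sub>v ((A ^\<^sub>m 0) *\<^sub>v w) = 0\<^sub>v z" by (rule spec)
    moreover have "(A ^\<^sub>m 0) *\<^sub>v w = w" using A wc by simp
    ultimately have "C *\<^sub>v w = 0\<^sub>v z" by (simp only:)
    moreover have "\<sigma> \<in> spectrum A"
      using w wc A by (auto simp: spectrum_def eigenvalue_def eigenvector_def)
    ultimately show False using R w wc by blast
  qed
qed

lemma all_less_add_iff:
  fixes n z :: nat
  shows "(\<forall>c<n + z. P c) \<longleftrightarrow> (\<forall>c<n. P c) \<and> (\<forall>q<z. P (n + q))"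
proof (intro iffI conjI allI impI; (elim conjE)?)
  fix c assume *: "\<forall>c<n. P c" "\<forall>q<z. P (n + q)" "c < n + z"
  show "P c"
  proof (cases "c < n")
    case False
    then have "c = n + (c - n)" "c - n < z" using *(3) by auto
    then show ?thesis using *(2) by metis
  qed (use * in blast)
qed auto

text \<open>Transposition, without conjugation, turns the blocks into \<sigma> I - A and C, whose
  common kernel consists of the eigenvectors for \<sigma> killed by \<open>C\<close>, and 0.\<close>

lemma rank_Hautus_matrix:
  fixes A C :: "'a::field mat"
  assumes A: "A \<in> carrier_mat n n" and C: "C \<in> carrier_mat z n"
  shows "vec_space.rank n (append_cols (\<sigma> \<cdot>\<^sub>m 1\<^sub>m n - transpose_mat A) (transpose_mat C)) = n \<longleftrightarrow>
    (\<forall>v\<in>carrier_vec n. A *\<^sub>v v = \<sigma> \<cdot>\<^sub>v v \<and> C *\<^sub>v v = 0\<^sub>v z \<longrightarrow> v = 0\<^sub>v n)"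
proof -
  let ?M = "append_cols (\<sigma> \<cdot>\<^sub>m 1\<^sub>m n - transpose_mat A) (transpose_mat C)"
  have M: "?M \<in> carrier_mat n (n + z)" using A C by (simp add: append_cols_def)
  have "transpose_mat ?M *\<^sub>v v = 0\<^sub>v (n + z) \<longleftrightarrow> A *\<^sub>v v = \<sigma> \<cdot>\<^sub>v v \<and> C *\<^sub>v v = 0\<^sub>v z"
    if v: "v \<in> carrier_vec n" for v
  proof -
    have Mv: "(transpose_mat ?M *\<^sub>v v) $ c = (\<Sum>i<n. ?M $$ (i, c) * v $ i)" if "c < n + z" for c
      using that M v by (simp add: scalar_prod_def atLeast0LessThan)
    have low: "(transpose_mat ?M *\<^sub>v v) $ c = \<sigma> * v $ c - (A *\<^sub>v v) $ c" if c: "c < n" for c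
    proof -
      have "?M $$ (i, c) * v $ i = (if i = c then \<sigma> * v $ i else 0) - A $$ (c, i) * v $ i" if "i < n" for i
        using that c A C by (simp add: append_cols_def left_diff_distrib)
      then have "(transpose_mat ?M *\<^sub>v v) $ c = (\<Sum>i<n. (if i = c then \<sigma> * v $ i else 0) - A $$ (c, i) * v $ i)"
        using c by (simp add: Mv del: index_mult_mat_vec)
      also have "\<dots> = \<sigma> * v $ c - (A *\<^sub>v v) $ c"
        using c A v by (simp add: sum_subtractf scalar_prod_def atLeast0LessThan)
      finally show ?thesis .
    qed
    have high: "(transpose_mat ?M *\<^sub>v v) $ (n + q) = (C *\<^sub>v v) $ q" if q: "q < z" for q
    proof -
      have "?M $$ (i, n + q) = C $$ (q, i)" if "i < n" for i
        using that q A C by (simp add: append_cols_def)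
      then show ?thesis using q C v by (simp add: Mv scalar_prod_def atLeast0LessThan del: index_mult_mat_vec)
          (simp add: scalar_prod_def atLeast0LessThan)
    qed
    have "transpose_mat ?M *\<^sub>v v = 0\<^sub>v (n + z) \<longleftrightarrow> (\<forall>c<n + z. (transpose_mat ?M *\<^sub>v v) $ c = 0)"
      using M by (auto simp: vec_eq_iff simp del: index_mult_mat_vec)
    also have "\<dots> \<longleftrightarrow> (\<forall>c<n. (transpose_mat ?M *\<^sub>v v) $ c = 0) \<and> (\<forall>q<z. (transpose_mat ?M *\<^sub>v v) $ (n + q) = 0)"
      by (rule all_less_add_iff)
    also have "\<dots> \<longleftrightarrow> (\<forall>c<n. (A *\<^sub>v v) $ c = \<sigma> * v $ c) \<and> (\<forall>q<z. (C *\<^sub>v v) $ q = 0)"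
      by (auto simp: low high simp del: index_mult_mat_vec)
    also have "\<dots> \<longleftrightarrow> A *\<^sub>v v = \<sigma> \<cdot>\<^sub>v v \<and> C *\<^sub>v v = 0\<^sub>v z"
      using A C v by (auto simp: vec_eq_iff simp del: index_mult_mat_vec)
    finally show ?thesis .
  qed
  then show ?thesis using rank_eq_dim_row_iff[OF M] by auto
qed

section \<open>The observability Gramian\<close>

lemma sum_lessThan_mult:
  fixes f :: "nat \<Rightarrow> 'a::comm_monoid_add"
  shows "(\<Sum>c<k * n. f c) = (\<Sum>j<k. \<Sum>q<n. f (j * n + q))"
proof -
  have "(\<Sum>c<k * n. f c) = (\<Sum>j<k. sum f {j * n..<j * n + n})"
    by (rule sum.nat_group[symmetric])
  also have "\<dots> = (\<Sum>j<k. \<Sum>q<n. f (j * n + q))"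
    using sum.shift_bounds_nat_ivl[of f 0 "_ * n" n] by (simp add: atLeast0LessThan add.commute)
  finally show ?thesis .
qed

lemma Psi_carrier: "A \<in> carrier_mat n n \<Longrightarrow> Psi k \<alpha> A t \<in> carrier_mat n (k * n)"
  by (auto simp: Psi_def block_row_def)

lemma Psi_index:
  assumes A: "A \<in> carrier_mat n n" and "p < n" "c < k * n"
  shows "Psi k \<alpha> A t $$ (p, c) = t ^ (c div n) *
    ml_series (\<lambda>l. (A ^\<^sub>m l) $$ (p, c mod n)) \<alpha> (real (c div n)) (t powr \<alpha>)"
proof -
  have "c mod n < n" using assms(2) by simp
  then show ?thesis using assms by (simp add: Psi_def block_row_def Phi_def ml_series_def)
qed

text \<open>The k blocks of length n of \<open>w\<close> are the initial vectors; this identifies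
  the Gramian's integrand with outputs of solutions.\<close>

lemma Psi_mult_vec:
  assumes A: "A \<in> carrier_mat n n" and w: "w \<in> carrier_vec (k * n)" and "0 < \<alpha>"
  shows "Psi k \<alpha> A t *\<^sub>v w = free_state k \<alpha> A (\<lambda>j. vec n (\<lambda>q. w $ (j * n + q))) t"
proof (rule eq_vecI)
  let ?V = "\<lambda>j. vec n (\<lambda>q. w $ (j * n + q))"
  fix p assume "p < dim_vec (free_state k \<alpha> A ?V t)"
  then have p: "p < n" using A by (simp add: free_state_def)
  have "(Psi k \<alpha> A t *\<^sub>v w) $ p = (\<Sum>c<k * n. Psi k \<alpha> A t $$ (p, c) * w $ c)"
    using Psi_carrier[OF A, of k \<alpha> t] w p by (simp add: scalar_prod_def atLeast0LessThan)
  also have "\<dots> = (\<Sum>j<k. \<Sum>q<n. Psi k \<alpha> A t $$ (p, j * n + q) * w $ (j * n + q))"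
    by (rule sum_lessThan_mult)
  also have "\<dots> = (\<Sum>j<k. \<Sum>q<n. t ^ j * (w $ (j * n + q) *
      ml_series (\<lambda>l. (A ^\<^sub>m l) $$ (p, q)) \<alpha> (real j) (t powr \<alpha>)))"
    by (intro sum.cong refl) (simp add: Psi_index[OF A p] block_index_less)
  also have "\<dots> = (\<Sum>j<k. t ^ j * ml_series (\<lambda>l. \<Sum>q<n. w $ (j * n + q) * (A ^\<^sub>m l) $$ (p, q))
      \<alpha> (real j) (t powr \<alpha>))"
    unfolding sum_distrib_left[symmetric] using assms(3)
    by (intro sum.cong refl arg_cong2[where f = "(*)"] ml_series_sum[symmetric]
        geom_bounded_pow_mat[OF A p]) auto
  also have "\<dots> = free_state k \<alpha> A ?V t $ p"
    using A p by (simp add: free_state_def scalar_prod_def atLeast0LessThan mult.commute)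
  finally show "(Psi k \<alpha> A t *\<^sub>v w) $ p = free_state k \<alpha> A ?V t $ p" .
qed (use A Psi_carrier[OF A, of k \<alpha> t] in \<open>simp add: free_state_def\<close>)

lemma continuous_on_Psi_index:
  assumes A: "A \<in> carrier_mat n n" and "p < n" "c < k * n" "0 < \<alpha>"
  shows "continuous_on {0..T} (\<lambda>t. Psi k \<alpha> A t $$ (p, c))"
proof -
  have "c mod n < n" using assms(2) by simp
  then have "geom_bounded (\<lambda>l. (A ^\<^sub>m l) $$ (p, c mod n))"
    by (rule geom_bounded_pow_mat[OF A assms(2)])
  then have "continuous_on {0..} (\<lambda>t. Psi k \<alpha> A t $$ (p, c))"
    unfolding Psi_index[OF A assms(2,3)] using assms(4)
    by (intro continuous_on_mult continuous_on_ml_series_powr continuous_on_power continuous_on_id) auto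
  then show ?thesis by (rule continuous_on_subset) auto
qed

lemma mult_mat_vec_nth:
  assumes "N \<in> carrier_mat r K" "w \<in> carrier_vec K" "q < r"
  shows "(N *\<^sub>v w) $ q = (\<Sum>a<K. N $$ (q, a) * w $ a)"
  using assms by (simp add: scalar_prod_def atLeast0LessThan)

lemma transpose_mult_self_index:
  assumes "N \<in> carrier_mat r K" "a < K" "b < K"
  shows "(transpose_mat N * N) $$ (a, b) = (\<Sum>q<r. N $$ (q, a) * N $$ (q, b))"
  using assms by (simp add: scalar_prod_def atLeast0LessThan)

context
  fixes n z k :: nat and \<alpha> :: real and A C :: "real mat"
  assumes A: "A \<in> carrier_mat n n" and C: "C \<in> carrier_mat z n" and \<alpha>: "0 < \<alpha>"
begin

lemma obs_output_carrier: "C * Psi k \<alpha> A t \<in> carrier_mat z (k * n)"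
  by (rule mult_carrier_mat[OF C Psi_carrier[OF A]])

lemma obs_integrand_index:
  assumes "a < k * n" "b < k * n"
  shows "(transpose_mat (Psi k \<alpha> A t) * transpose_mat C * C * Psi k \<alpha> A t) $$ (a, b) =
    (\<Sum>q<z. (C * Psi k \<alpha> A t) $$ (q, a) * (C * Psi k \<alpha> A t) $$ (q, b))"
proof -
  let ?P = "Psi k \<alpha> A t" and ?N = "C * Psi k \<alpha> A t"
  have P: "?P \<in> carrier_mat n (k * n)" by (rule Psi_carrier[OF A])
  have "transpose_mat ?P * transpose_mat C * C * ?P = transpose_mat ?N * C * ?P"
    by (simp add: transpose_mult[OF C P])
  also have "\<dots> = transpose_mat ?N * ?N"
    using obs_output_carrier[of t] C P by (intro assoc_mult_mat) auto
  finally show ?thesis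
    using transpose_mult_self_index[OF obs_output_carrier assms] by simp
qed

lemma continuous_on_obs_output:
  assumes "q < z" "c < k * n"
  shows "continuous_on {0..T} (\<lambda>t. (C * Psi k \<alpha> A t) $$ (q, c))"
proof -
  have "(C * Psi k \<alpha> A t) $$ (q, c) = (\<Sum>p<n. C $$ (q, p) * Psi k \<alpha> A t $$ (p, c))" for t
    using assms C Psi_carrier[OF A, of k \<alpha> t] by (simp add: scalar_prod_def atLeast0LessThan)
  then show ?thesis
    using assms continuous_on_Psi_index[OF A _ _ \<alpha>]
    by (simp only:) (intro continuous_on_sum continuous_on_mult_left, simp)
qed

lemma obs_gramian_index:
  assumes "a < k * n" "b < k * n"
  shows "obs_gramian k \<alpha> A C T $$ (a, b) = integral {0..T}
    (\<lambda>t. \<Sum>q<z. (C * Psi k \<alpha> A t) $$ (q, a) * (C * Psi k \<alpha> A t) $$ (q, b))"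
  using assms A by (simp add: obs_gramian_def obs_integrand_index)

lemma obs_gramian_carrier: "obs_gramian k \<alpha> A C T \<in> carrier_mat (k * n) (k * n)"
  using A by (simp add: obs_gramian_def)

text \<open>The Gramian is integrated entrywise, so finite sums have to be exchanged with the
  integral. Continuity is recorded too, since it lets a zero integral force a zero output.\<close>

lemma obs_gramian_quadratic_form:
  assumes w: "w \<in> carrier_vec (k * n)"
  defines "x \<equiv> free_state k \<alpha> A (\<lambda>j. vec n (\<lambda>q. w $ (j * n + q)))"
  shows "w \<bullet> (obs_gramian k \<alpha> A C T *\<^sub>v w) = integral {0..T} (\<lambda>t. \<Sum>q<z. ((C *\<^sub>v x t) $ q)\<^sup>2)"
    and "continuous_on {0..T} (\<lambda>t. \<Sum>q<z. ((C *\<^sub>v x t) $ q)\<^sup>2)"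
proof -
  let ?W = "obs_gramian k \<alpha> A C T" and ?N = "\<lambda>t. C * Psi k \<alpha> A t" and ?I = "{..<k * n}"
  have out: "(C *\<^sub>v x t) $ q = (\<Sum>a\<in>?I. ?N t $$ (q, a) * w $ a)" if "q < z" for q t
  proof -
    have "C *\<^sub>v x t = ?N t *\<^sub>v w"
      unfolding x_def Psi_mult_vec[OF A w \<alpha>, symmetric]
      by (rule assoc_mult_mat_vec[symmetric, OF C Psi_carrier[OF A] w])
    then show ?thesis using mult_mat_vec_nth[OF obs_output_carrier w that] by simp
  qed
  show cont: "continuous_on {0..T} (\<lambda>t. \<Sum>q<z. ((C *\<^sub>v x t) $ q)\<^sup>2)"
    by (simp add: out del: index_mult_mat_vec index_mult_mat(1))
       (intro continuous_on_sum continuous_on_power continuous_on_mult_right continuous_on_obs_output; simp)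
  let ?g = "\<lambda>a b t. \<Sum>q<z. ?N t $$ (q, a) * ?N t $$ (q, b)"
  have int: "?g a b integrable_on {0..T}" if "a \<in> ?I" "b \<in> ?I" for a b
    using that
    by (intro integrable_continuous_interval continuous_on_sum continuous_on_mult
        continuous_on_obs_output) auto
  have "w \<bullet> (?W *\<^sub>v w) = (\<Sum>a\<in>?I. \<Sum>b\<in>?I. w $ a * w $ b * ?W $$ (a, b))"
    using w obs_gramian_carrier[of T]
    by (simp add: scalar_prod_def atLeast0LessThan sum_distrib_left mult_ac)
  also have "\<dots> = (\<Sum>a\<in>?I. \<Sum>b\<in>?I. integral {0..T} (\<lambda>t. w $ a * w $ b * ?g a b t))"
    by (intro sum.cong refl) (simp add: obs_gramian_index del: index_mult_mat(1))
  also have "\<dots> = (\<Sum>a\<in>?I. integral {0..T} (\<lambda>t. \<Sum>b\<in>?I. w $ a * w $ b * ?g a b t))"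
    by (intro sum.cong refl integral_sum[symmetric] finite_lessThan integrable_on_mult_right int)
  also have "\<dots> = integral {0..T} (\<lambda>t. \<Sum>a\<in>?I. \<Sum>b\<in>?I. w $ a * w $ b * ?g a b t)"
    by (intro integral_sum[symmetric] finite_lessThan integrable_sum integrable_on_mult_right int)
  finally have form: "w \<bullet> (?W *\<^sub>v w) = \<dots>" .
  have pt: "(\<Sum>a\<in>?I. \<Sum>b\<in>?I. w $ a * w $ b * ?g a b t) = (\<Sum>q<z. ((C *\<^sub>v x t) $ q)\<^sup>2)" for t
  proof -
    have "(\<Sum>q<z. ((C *\<^sub>v x t) $ q)\<^sup>2) =
        (\<Sum>q<z. \<Sum>a\<in>?I. \<Sum>b\<in>?I. (?N t $$ (q, a) * w $ a) * (?N t $$ (q, b) * w $ b))"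
      by (simp add: out power2_eq_square sum_product del: index_mult_mat_vec index_mult_mat(1))
    also have "\<dots> = (\<Sum>a\<in>?I. \<Sum>b\<in>?I. \<Sum>q<z. (?N t $$ (q, a) * w $ a) * (?N t $$ (q, b) * w $ b))"
      by (subst sum.swap, subst (2) sum.swap) (rule refl)
    finally show ?thesis by (simp add: sum_distrib_left mult_ac del: index_mult_mat(1))
  qed
  show "w \<bullet> (?W *\<^sub>v w) = integral {0..T} (\<lambda>t. \<Sum>q<z. ((C *\<^sub>v x t) $ q)\<^sup>2)"
    unfolding form pt ..
qed

lemma transpose_obs_gramian: "transpose_mat (obs_gramian k \<alpha> A C T) = obs_gramian k \<alpha> A C T"
  using obs_gramian_carrier[of T]
  by (intro eq_matI) (auto simp: obs_gramian_index mult.commute simp del: index_mult_mat(1))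

lemma pos_def_obs_gramian_imp:
  assumes "0 < k" and pd: "pos_def_mat (obs_gramian k \<alpha> A C T)" and v: "unobservable A C v"
  shows "v = 0\<^sub>v n"
proof (rule ccontr)
  assume ne: "v \<noteq> 0\<^sub>v n"
  have vc: "v \<in> carrier_vec n" using v A by (simp add: unobservable_def)
  \<comment> \<open>All k blocks of \<open>w\<close> are \<open>v\<close>; as k > 0, this vector is
    nonzero when \<open>v\<close> is.\<close>
  define w where "w = vec (k * n) (\<lambda>c. v $ (c mod n))"
  have w: "w \<in> carrier_vec (k * n)" by (simp add: w_def)
  have V: "vec n (\<lambda>q. w $ (j * n + q)) = v" if "j < k" for j
  proof (rule eq_vecI)
    fix q assume "q < dim_vec v"
    then have q: "q < n" using vc by simp
    have "j * n + q < k * n" using that q by (rule block_index_less)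
    then show "vec n (\<lambda>q. w $ (j * n + q)) $ q = v $ q" using q by (simp add: w_def)
  qed (use vc in simp)
  have "w \<noteq> 0\<^sub>v (k * n)"
  proof
    assume w0: "w = 0\<^sub>v (k * n)"
    have "v $ q = 0" if "q < n" for q
    proof -
      have "q < k * n" using that assms(1) by (cases k) auto
      then show ?thesis using arg_cong[OF w0, of "\<lambda>w. w $ q"] that by (simp add: w_def)
    qed
    then show False using ne vc by (auto simp: vec_eq_iff)
  qed
  then have "0 < w \<bullet> (obs_gramian k \<alpha> A C T *\<^sub>v w)"
    using pd w obs_gramian_carrier[of T] by (auto simp: pos_def_mat_def)
  moreover have "C *\<^sub>v free_state k \<alpha> A (\<lambda>j. vec n (\<lambda>q. w $ (j * n + q))) t = 0\<^sub>v z" for t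
    by (rule mult_free_state_unobservable[OF A C \<alpha>]) (simp add: V v)
  ultimately show False unfolding obs_gramian_quadratic_form(1)[OF w] by simp
qed

text \<open>If the form vanishes at \<open>w\<close>, the continuous nonnegative integrand is 0 on
  all of [0, T]. The free responses to the blocks of \<open>w\<close> and to 0 then have equal
  outputs, and observability makes every block 0.\<close>

lemma observable_imp_pos_def_obs_gramian:
  assumes k: "0 < k" "real k - 1 < \<alpha>" "\<alpha> \<le> real k" and B: "B \<in> carrier_mat n m"
    and T: "0 < T" and obs: "observable k \<alpha> A B C T"
  shows "pos_def_mat (obs_gramian k \<alpha> A C T)"
  unfolding pos_def_mat_def
proof (intro conjI ballI impI)
  show "square_mat (obs_gramian k \<alpha> A C T)" using obs_gramian_carrier[of T] by auto
  show "transpose_mat (obs_gramian k \<alpha> A C T) = obs_gramian k \<alpha> A C T"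
    by (rule transpose_obs_gramian)
  fix w :: "real vec"
  assume "w \<in> carrier_vec (dim_row (obs_gramian k \<alpha> A C T))"
    and "w \<noteq> 0\<^sub>v (dim_row (obs_gramian k \<alpha> A C T))"
  then have w: "w \<in> carrier_vec (k * n)" and ne: "w \<noteq> 0\<^sub>v (k * n)"
    using obs_gramian_carrier[of T] by auto
  let ?V = "\<lambda>j. vec n (\<lambda>q. w $ (j * n + q))"
  let ?x = "free_state k \<alpha> A ?V" and ?x' = "free_state k \<alpha> A (\<lambda>_. 0\<^sub>v n)"
  let ?h = "\<lambda>t. \<Sum>q<z. ((C *\<^sub>v ?x t) $ q)\<^sup>2"
  have nn: "0 \<le> ?h t" for t by (intro sum_nonneg) simp
  have "integral {0..T} ?h \<noteq> 0"
  proof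
    assume "integral {0..T} ?h = 0"
    then have h0: "?h t = 0" if "t \<in> {0..T}" for t
      using integral_eq_0_iff[OF obs_gramian_quadratic_form(2)[OF w] T nn] that by blast
    have out: "C *\<^sub>v ?x t = C *\<^sub>v ?x' t" if "t \<in> {0..T}" for t
    proof -
      have "(C *\<^sub>v ?x t) $ q = 0" if "q < z" for q
        using h0[OF \<open>t \<in> {0..T}\<close>] that by (simp add: sum_nonneg_eq_0_iff del: index_mult_mat_vec)
      then have "C *\<^sub>v ?x t = 0\<^sub>v z" using C by (intro eq_vecI) (auto simp del: index_mult_mat_vec)
      moreover have "unobservable A C (0\<^sub>v n)" by (rule unobservable_zero[OF A C])
      then have "C *\<^sub>v ?x' t = 0\<^sub>v z" by (rule mult_free_state_unobservable[OF A C \<alpha>])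
      ultimately show ?thesis by simp
    qed
    have sol: "caputo_solution k \<alpha> A B (\<lambda>_. 0\<^sub>v (dim_col B)) V (free_state k \<alpha> A V)"
      if "\<And>j. V j \<in> carrier_vec n" for V
      using caputo_solution_free_state[OF A B that k \<alpha>] B by simp
    have "?V j = 0\<^sub>v n" if "j < k" for j
      using obs[unfolded observable_def, THEN spec, THEN spec, THEN spec, THEN spec, THEN spec,
          of "\<lambda>_. 0\<^sub>v (dim_col B)" ?V "\<lambda>_. 0\<^sub>v n" ?x ?x']
        admissible_control_zero[of "dim_col B"] sol[of ?V] sol[of "\<lambda>_. 0\<^sub>v n"] out A that by simp
    have "w $ c = 0" if c: "c < k * n" for c
    proof -
      have n: "0 < n" using c by (cases n) auto
      then have "c div n < k" using c by (simp add: less_mult_imp_div_less)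
      then have "?V (c div n) $ (c mod n) = 0\<^sub>v n $ (c mod n)"
        using \<open>\<And>j. j < k \<Longrightarrow> ?V j = 0\<^sub>v n\<close> by metis
      then show ?thesis using n by simp
    qed
    then show False using ne w by (auto simp: vec_eq_iff)
  qed
  moreover have "0 \<le> integral {0..T} ?h"
    using obs_gramian_quadratic_form(2)[OF w] nn
    by (intro integral_nonneg integrable_continuous_interval) auto
  ultimately show "0 < w \<bullet> (obs_gramian k \<alpha> A C T *\<^sub>v w)"
    unfolding obs_gramian_quadratic_form(1)[OF w] by simp
qed

end

theorem corollary4p5:
  fixes n m z k \<mu> :: nat and \<alpha> t :: real and A B C :: "real mat"
  assumes "0 < n" and "0 < m" and "0 < z" and "z \<le> n"
    and "A \<in> carrier_mat n n" and "B \<in> carrier_mat n m" and "C \<in> carrier_mat z n"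
    and "\<mu> = degree (minimal_poly A)"
    and "0 < \<alpha>" and "0 < k" and "real k - 1 < \<alpha>" and "\<alpha> \<le> real k"
    and "0 < t"
  shows
    "(observable k \<alpha> A B C t \<longleftrightarrow>
        vec_space.rank n
          (block_row n z \<mu> (\<lambda>l. (transpose_mat A) ^\<^sub>m l * transpose_mat C)) = n) \<and>
     (observable k \<alpha> A B C t \<longleftrightarrow>
        (\<forall>\<sigma>\<in>spectrum (map_mat complex_of_real A).
           vec_space.rank n
             (append_cols (\<sigma> \<cdot>\<^sub>m 1\<^sub>m n - map_mat complex_of_real (transpose_mat A))
                          (map_mat complex_of_real (transpose_mat C))) = n)) \<and>
     (observable k \<alpha> A B C t \<longleftrightarrow>
        (\<forall>T>0. pos_def_mat (obs_gramian k \<alpha> A C T)))"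
proof -
  note A = assms(5) and B = assms(6) and C = assms(7)
  note k = assms(10-12,9)
  let ?triv = "\<forall>v. unobservable A C v \<longrightarrow> v = 0\<^sub>v n"
  let ?Ac = "map_mat complex_of_real A" and ?Cc = "map_mat complex_of_real C"
  have Ac: "?Ac \<in> carrier_mat n n" and Cc: "?Cc \<in> carrier_mat z n" using A C by auto
  \<comment> \<open>Stated for every T, because the Gramian condition ranges over all intervals
    while \<open>t\<close> is fixed; \<open>?triv\<close> does not mention the interval.\<close>
  have obs: "observable k \<alpha> A B C T \<longleftrightarrow> ?triv" if "0 < T" for T
    using observable_imp_unobservable_zero[OF A B C k] that
      unobservable_zero_imp_observable[OF A B C k(1,3) that] by blast
  have 1: "vec_space.rank n (block_row n z \<mu> (\<lambda>l. (transpose_mat A) ^\<^sub>m l * transpose_mat C)) = n \<longleftrightarrow> ?triv"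
  proof -
    have "unobservable A C v \<longleftrightarrow> v \<in> carrier_vec n \<and> (\<forall>l<\<mu>. C *\<^sub>v ((A ^\<^sub>m l) *\<^sub>v v) = 0\<^sub>v z)" for v
      using unobservable_iff_minimal_poly[OF A C, of v] A assms(8) by (auto simp: unobservable_def)
    then show ?thesis unfolding rank_observability_matrix[OF A C] by blast
  qed
  have "?triv \<longleftrightarrow> (\<forall>v. unobservable ?Ac ?Cc v \<longrightarrow> v = 0\<^sub>v n)"
  proof
    assume t: ?triv
    show "\<forall>v. unobservable ?Ac ?Cc v \<longrightarrow> v = 0\<^sub>v n"
    proof (intro allI impI)
      fix v assume v: "unobservable ?Ac ?Cc v"
      then have vc: "v \<in> carrier_vec n" using A by (simp add: unobservable_def)
      then have "map_vec Re v = 0\<^sub>v n" "map_vec Im v = 0\<^sub>v n"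
        using v t map_mat_unobservable[OF A C vc] by auto
      then show "v = 0\<^sub>v n" using vc by (auto simp: vec_eq_iff complex_eq_iff)
    qed
  next
    assume t: "\<forall>v. unobservable ?Ac ?Cc v \<longrightarrow> v = 0\<^sub>v n"
    show ?triv
    proof (intro allI impI)
      fix v assume v: "unobservable A C v"
      then have vc: "v \<in> carrier_vec n" using A by (simp add: unobservable_def)
      let ?v = "map_vec complex_of_real v"
      have "map_vec Re ?v = v" "map_vec Im ?v = 0\<^sub>v n" using vc by (auto simp: vec_eq_iff)
      then have "unobservable ?Ac ?Cc ?v"
        using map_mat_unobservable[OF A C, of ?v] v vc unobservable_zero[OF A C] by simp
      then have "?v = 0\<^sub>v n" using t by blast
      then show "v = 0\<^sub>v n" using vc by (auto simp: vec_eq_iff)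
    qed
  qed
  then have 2: "?triv \<longleftrightarrow> (\<forall>\<sigma>\<in>spectrum ?Ac. vec_space.rank n
      (append_cols (\<sigma> \<cdot>\<^sub>m 1\<^sub>m n - map_mat complex_of_real (transpose_mat A))
        (map_mat complex_of_real (transpose_mat C))) = n)"
    unfolding Hautus_criterion[OF Ac Cc] map_mat_transpose[symmetric] rank_Hautus_matrix[OF Ac Cc] .
  have 3: "?triv \<longleftrightarrow> (\<forall>T>0. pos_def_mat (obs_gramian k \<alpha> A C T))"
  proof
    assume ?triv
    then show "\<forall>T>0. pos_def_mat (obs_gramian k \<alpha> A C T)"
      using obs observable_imp_pos_def_obs_gramian[OF A C k(4) k(1-3) B] by blast
  next
    assume "\<forall>T>0. pos_def_mat (obs_gramian k \<alpha> A C T)"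
    \<comment> \<open>One interval suffices for this direction; its length 1 is arbitrary.\<close>
    then have "pos_def_mat (obs_gramian k \<alpha> A C 1)" by simp
    then show ?triv using pos_def_obs_gramian_imp[OF A C k(4,1)] by blast
  qed
  show ?thesis using obs[OF assms(13)] 1 2 3 by blast
qed

end
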